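(* For $(\rho;\sigma),(\mu;\nu)\in\mathcal{Q}_n$, one has $\mathcal{O}_{\rho;\sigma}\subseteq\overline{\mathcal{O}_{\mu;\nu}}$ (Zariski closure in $V\times\mathcal{N}$) if and only if $(\rho;\sigma)\le(\mu;\nu)$.
   Context: $\mathbb{F}$ is an algebraically closed field, $V$ an $n$-dimensional $\mathbb{F}$-vector space, $G=\mathrm{GL}(V)$, $\mathcal{N}$ the variety of nilpotent endomorphisms of $V$; $G$ acts on $V\times\mathcal{N}$ by $g\cdot(v,x)=(gv,gxg^{-1})$. $\mathcal{Q}_n$ is the set of bipartitions $(\mu;\nu)$ (ordered pairs of partitions) with $|\mu|+|\nu|=n$. $\mathcal{O}_{\mu;\nu}\subset V\times\mathcal{N}$ is the $G$-orbit consisting of the $(v,x)$ for which there is a basis $\{v_{ij}\mid 1\le i\le\ell(\mu+\nu),1\le j\le\mu_i+\nu_i\}$ of $V$ with $xv_{ij}=v_{i,j-1}$ for $j>1$, $xv_{i1}=0$, and $v=\sum_{i=1}^{\ell(\mu)}v_{i,\mu_i}$ (here $\mu+\nu$ is the termwise sum and $\ell$ denotes the number of nonzero parts). The partial order on $\mathcal{Q}_n$: $(\rho;\sigma)\le(\mu;\nu)$ if and only if for all $k\ge0$ $$\rho_1+\sigma_1+\cdots+\rho_k+\sigma_k\le\mu_1+\nu_1+\cdots+\mu_k+\nu_k$$ and $$\rho_1+\sigma_1+\cdots+\rho_k+\sigma_k+\rho_{k+1}\le\mu_1+\nu_1+\cdots+\mu_k+\nu_k+\mu_{k+1}.$$ 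*)

theory Defs
  imports "HOL-Analysis.Abstract_Topology" "HOL-Computational_Algebra.Polynomial"
begin

text \<open>
  A partition is an infinite weakly decreasing sequence of naturals with finitely many nonzero
  terms.  Parts are indexed from 0: the value at \<open>i\<close> is the part usually written with index
  \<open>i + 1\<close>.
\<close>

definition is_partition :: "(nat \<Rightarrow> nat) \<Rightarrow> bool" where
  "is_partition \<mu> \<longleftrightarrow> antimono \<mu> \<and> finite {i. \<mu> i \<noteq> 0}"

definition part_size :: "(nat \<Rightarrow> nat) \<Rightarrow> nat" where
  "part_size \<mu> = (\<Sum>i | \<mu> i \<noteq> 0. \<mu> i)"

definition part_length :: "(nat \<Rightarrow> nat) \<Rightarrow> nat" where
  "part_length \<mu> = card {i. \<mu> i \<noteq> 0}"

definition bipartitions :: "nat \<Rightarrow> ((nat \<Rightarrow> nat) \<times> (nat \<Rightarrow> nat)) set" where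
  "bipartitions n =
    {(\<mu>, \<nu>). is_partition \<mu> \<and> is_partition \<nu> \<and> part_size \<mu> + part_size \<nu> = n}"

definition bipartition_le ::
  "(nat \<Rightarrow> nat) \<times> (nat \<Rightarrow> nat) \<Rightarrow> (nat \<Rightarrow> nat) \<times> (nat \<Rightarrow> nat) \<Rightarrow> bool" where
  "bipartition_le = (\<lambda>(\<rho>, \<sigma>) (\<mu>, \<nu>). \<forall>k.
    (\<Sum>i<k. \<rho> i + \<sigma> i) \<le> (\<Sum>i<k. \<mu> i + \<nu> i) \<and>
    (\<Sum>i<k. \<rho> i + \<sigma> i) + \<rho> k \<le> (\<Sum>i<k. \<mu> i + \<nu> i) + \<mu> k)"

text \<open>
  From here on \<open>scale\<close> is the scalar multiplication of a vector space over \<open>'a\<close>,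
  and the vector space \<open>V\<close> is the whole type \<open>'b\<close>.
\<close>

definition nilpotent_endos ::
  "('a::field \<Rightarrow> 'b::ab_group_add \<Rightarrow> 'b) \<Rightarrow> ('b \<Rightarrow> 'b) set" where
  "nilpotent_endos scale = {x. Vector_Spaces.linear scale scale x \<and> (\<exists>m. \<forall>w. (x ^^ m) w = 0)}"

definition enhanced_cone ::
  "('a::field \<Rightarrow> 'b::ab_group_add \<Rightarrow> 'b) \<Rightarrow> ('b \<times> ('b \<Rightarrow> 'b)) set" where
  "enhanced_cone scale = UNIV \<times> nilpotent_endos scale"

text \<open>
  The polynomial functions on \<open>V \<times> End(V)\<close>: the algebra generated by the linear functionals.
  For finite-dimensional \<open>V\<close>, the dual of \<open>End(V)\<close> is spanned by the matrix coefficients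
  \<open>x \<mapsto> \<phi> (x w)\<close>.  Values at functions \<open>x\<close> that are not linear are junk and play no role,
  as only points of \<open>V \<times> N\<close> are considered below.
\<close>

inductive_set poly_funs ::
  "('a::field \<Rightarrow> 'b::ab_group_add \<Rightarrow> 'b) \<Rightarrow> ('b \<times> ('b \<Rightarrow> 'b) \<Rightarrow> 'a) set"
  for scale :: "'a::field \<Rightarrow> 'b::ab_group_add \<Rightarrow> 'b" where
  const: "(\<lambda>_. c) \<in> poly_funs scale"
| vector_coord: "Vector_Spaces.linear scale (*) \<phi> \<Longrightarrow> (\<lambda>(v, x). \<phi> v) \<in> poly_funs scale"
| matrix_coeff: "Vector_Spaces.linear scale (*) \<phi> \<Longrightarrow> (\<lambda>(v, x). \<phi> (x w)) \<in> poly_funs scale"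
| add: "f \<in> poly_funs scale \<Longrightarrow> g \<in> poly_funs scale \<Longrightarrow> (\<lambda>p. f p + g p) \<in> poly_funs scale"
| mult: "f \<in> poly_funs scale \<Longrightarrow> g \<in> poly_funs scale \<Longrightarrow> (\<lambda>p. f p * g p) \<in> poly_funs scale"

definition zero_locus ::
  "('a::field \<Rightarrow> 'b::ab_group_add \<Rightarrow> 'b) \<Rightarrow> ('b \<times> ('b \<Rightarrow> 'b) \<Rightarrow> 'a) set \<Rightarrow>
     ('b \<times> ('b \<Rightarrow> 'b)) set" where
  "zero_locus scale P = {p \<in> enhanced_cone scale. \<forall>f\<in>P. f p = 0}"

definition zariski ::
  "('a::field \<Rightarrow> 'b::ab_group_add \<Rightarrow> 'b) \<Rightarrow> ('b \<times> ('b \<Rightarrow> 'b)) topology" where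
  "zariski scale =
    topology (\<lambda>U. \<exists>P\<subseteq>poly_funs scale. U = enhanced_cone scale - zero_locus scale P)"

lemma istopology_zariski:
  "istopology (\<lambda>U. \<exists>P\<subseteq>poly_funs scale. U = enhanced_cone scale - zero_locus scale P)"
  unfolding istopology_def
proof (intro conjI allI impI)
  fix S T
  assume "\<exists>P\<subseteq>poly_funs scale. S = enhanced_cone scale - zero_locus scale P"
    and "\<exists>P\<subseteq>poly_funs scale. T = enhanced_cone scale - zero_locus scale P"
  then obtain P Q where P: "P \<subseteq> poly_funs scale" "S = enhanced_cone scale - zero_locus scale P"
    and Q: "Q \<subseteq> poly_funs scale" "T = enhanced_cone scale - zero_locus scale Q" by blast
  let ?R = "{\<lambda>p. f p * g p | f g. f \<in> P \<and> g \<in> Q}"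
  have "?R \<subseteq> poly_funs scale"
    using P(1) Q(1) by (auto intro!: poly_funs.mult)
  moreover have "S \<inter> T = enhanced_cone scale - zero_locus scale ?R"
  proof (rule set_eqI)
    fix p
    have "(\<exists>h\<in>?R. h p \<noteq> 0) \<longleftrightarrow> (\<exists>f\<in>P. f p \<noteq> 0) \<and> (\<exists>g\<in>Q. g p \<noteq> 0)"
    proof
      assume "(\<exists>f\<in>P. f p \<noteq> 0) \<and> (\<exists>g\<in>Q. g p \<noteq> 0)"
      then obtain f g where "f \<in> P" "g \<in> Q" "f p * g p \<noteq> 0" by auto
      then show "\<exists>h\<in>?R. h p \<noteq> 0"
        by (intro bexI[of _ "\<lambda>p. f p * g p"]) auto
    qed auto
    then show "p \<in> S \<inter> T \<longleftrightarrow> p \<in> enhanced_cone scale - zero_locus scale ?R"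
      unfolding P(2) Q(2) zero_locus_def Int_iff Diff_iff mem_Collect_eq by meson
  qed
  ultimately show "\<exists>P\<subseteq>poly_funs scale. S \<inter> T = enhanced_cone scale - zero_locus scale P" by blast
next
  fix K
  assume "\<forall>U\<in>K. \<exists>P\<subseteq>poly_funs scale. U = enhanced_cone scale - zero_locus scale P"
  then obtain P where P: "\<And>U. U \<in> K \<Longrightarrow> P U \<subseteq> poly_funs scale"
      "\<And>U. U \<in> K \<Longrightarrow> U = enhanced_cone scale - zero_locus scale (P U)"
    by metis
  have "p \<in> \<Union>K \<longleftrightarrow> p \<in> enhanced_cone scale - zero_locus scale (\<Union>U\<in>K. P U)" for p
  proof -
    have "p \<in> U \<longleftrightarrow> p \<in> enhanced_cone scale \<and> (\<exists>f\<in>P U. f p \<noteq> 0)" if "U \<in> K" for U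
      using P(2)[OF that] unfolding zero_locus_def by blast
    then show ?thesis
      unfolding zero_locus_def by auto
  qed
  then have "\<Union>K = enhanced_cone scale - zero_locus scale (\<Union>U\<in>K. P U)" by blast
  moreover have "(\<Union>U\<in>K. P U) \<subseteq> poly_funs scale" using P(1) by blast
  ultimately show "\<exists>P\<subseteq>poly_funs scale. \<Union>K = enhanced_cone scale - zero_locus scale P" by blast
qed

lemma openin_zariski:
  "openin (zariski scale) U \<longleftrightarrow> (\<exists>P\<subseteq>poly_funs scale. U = enhanced_cone scale - zero_locus scale P)"
  unfolding zariski_def by (simp add: istopology_zariski)

lemma topspace_zariski: "topspace (zariski scale) = enhanced_cone scale"
proof -
  have "enhanced_cone scale = enhanced_cone scale - zero_locus scale {\<lambda>_. 1}"
    by (auto simp: zero_locus_def)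
  then have "openin (zariski scale) (enhanced_cone scale)"
    unfolding openin_zariski by (metis empty_subsetI insert_subset poly_funs.const)
  then show ?thesis
    unfolding topspace_def openin_zariski by blast
qed

lemma closedin_zariski:
  "closedin (zariski scale) Z \<longleftrightarrow> (\<exists>P\<subseteq>poly_funs scale. Z = zero_locus scale P)"
proof -
  have "zero_locus scale P \<subseteq> enhanced_cone scale" for P
    by (auto simp: zero_locus_def)
  then show ?thesis
    unfolding closedin_def topspace_zariski openin_zariski by blast
qed

text \<open>
  The basis vectors are \<open>e i j\<close> with \<open>i\<close> counted from 0 (like the parts) and \<open>j\<close> from 1.
\<close>

definition enhanced_orbit ::
  "('a::field \<Rightarrow> 'b::ab_group_add \<Rightarrow> 'b) \<Rightarrow> (nat \<Rightarrow> nat) \<times> (nat \<Rightarrow> nat) \<Rightarrow>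
     ('b \<times> ('b \<Rightarrow> 'b)) set" where
  "enhanced_orbit scale = (\<lambda>(\<mu>, \<nu>). {(v, x) \<in> enhanced_cone scale. \<exists>e :: nat \<Rightarrow> nat \<Rightarrow> 'b.
    let I = (SIGMA i:{..<part_length (\<lambda>i. \<mu> i + \<nu> i)}. {1..\<mu> i + \<nu> i}) in
      inj_on (\<lambda>(i, j). e i j) I \<and>
      \<not> module.dependent scale ((\<lambda>(i, j). e i j) ` I) \<and>
      module.span scale ((\<lambda>(i, j). e i j) ` I) = UNIV \<and>
      (\<forall>(i, j)\<in>I. x (e i j) = (if j > 1 then e i (j - 1) else 0)) \<and>
      v = (\<Sum>i<part_length \<mu>. e i (\<mu> i))})"

end

theory Submission
  imports Defs
begin

text \<open>
  A point \<open>(v, x)\<close> is described by generators \<open>w\<^sub>i\<close> of \<open>V\<close> as an \<open>F[x]\<close>-module with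
  \<open>x^(p\<^sub>i + q\<^sub>i) w\<^sub>i = 0\<close> and \<open>v = \<Sum>\<^sub>i x^(q\<^sub>i) w\<^sub>i\<close>.  Here \<open>(p\<^sub>i; q\<^sub>i)\<close> may be an arbitrary sequence of
  pairs rather than a bipartition, which leaves room for intermediate steps.

  For the existence of degenerations, three moves suffice: turning boxes of \<open>p\<^sub>i\<close> into boxes of
  \<open>q\<^sub>i\<close>, moving a box from \<open>q\<^sub>i\<close> to \<open>q\<^sub>j\<close>, and moving a box from \<open>q\<^sub>i\<close> to \<open>p\<^sub>j\<close>.  Each is realised by a
  line in \<open>V \<times> End(V)\<close> that lies in the larger orbit except at one point; for the last two, \<open>v\<close> is
  constant and \<open>x\<close> changes by multiples of an endomorphism of rank one.  In addition, a row
  \<open>(p\<^sub>j; q\<^sub>j)\<close> dominated by a row \<open>(p\<^sub>i; q\<^sub>i)\<close> with \<open>p\<^sub>j \<le> p\<^sub>i\<close> and \<open>q\<^sub>i \<le> q\<^sub>j\<close> can be changed freely within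
  these bounds without changing the orbit.  A combinatorial argument connects comparable
  bipartitions by such moves.

  Conversely, on the orbit of \<open>(\<mu>; \<nu>)\<close> the two partial sums in the order are the maximal
  dimensions of the submodules generated by \<open>k\<close> vectors, respectively by \<open>v\<close> and \<open>k\<close> further vectors,
  and these maxima can only drop in the closure because linear independence is an open condition.
\<close>

section \<open>Infinite fields, linear maps and functionals\<close>

lemma alg_closed_infinite: "infinite (UNIV :: 'a::alg_closed_field set)"
proof
  assume fin: "finite (UNIV :: 'a set)"
  \<comment> \<open>\<open>?q\<close> vanishes on the whole finite field, so \<open>?q + 1\<close>
    is a nonconstant polynomial without roots.\<close>
  let ?q = "\<Prod>a\<in>UNIV. [:- a, 1:] :: 'a poly"
  have deg: "degree ?q = card (UNIV :: 'a set)"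
    by (subst degree_prod_eq_sum_degree) auto
  moreover have "card (UNIV :: 'a set) > 0" using fin by (simp add: finite_UNIV_card_ge_0)
  ultimately have "degree (?q + 1) > 0"
    by (subst degree_add_eq_left) auto
  then obtain z where z: "poly (?q + 1) z = 0"
    using alg_closed_imp_poly_has_root by metis
  have "poly ?q z = 0"
    using fin by (auto simp: poly_prod intro!: bexI[of _ z])
  with z show False by simp
qed

lemma vector_space_linearI:
  assumes "vector_space s1" "vector_space s2"
    and "\<And>a b. f (a + b) = f a + f b" "\<And>c a. f (s1 c a) = s2 c (f a)"
  shows "Vector_Spaces.linear s1 s2 f"
  unfolding Vector_Spaces.linear_iff using assms by blast

context finite_dimensional_vector_space
begin

abbreviation endo :: "('b \<Rightarrow> 'b) \<Rightarrow> bool" where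
  "endo x \<equiv> Vector_Spaces.linear scale scale x"

abbreviation functional :: "('b \<Rightarrow> 'a) \<Rightarrow> bool" where
  "functional \<phi> \<equiv> Vector_Spaces.linear scale (*) \<phi>"

lemma endoD:
  assumes "endo x"
  shows "x (a + b) = x a + x b" "x (scale c a) = scale c (x a)" "x 0 = 0"
    "x (a - b) = x a - x b" "x (- a) = - x a" "x (sum g T) = (\<Sum>i\<in>T. x (g i))"
proof -
  interpret Vector_Spaces.linear scale scale x by fact
  show "x (a + b) = x a + x b" "x (scale c a) = scale c (x a)" "x 0 = 0"
    "x (a - b) = x a - x b" "x (- a) = - x a" "x (sum g T) = (\<Sum>i\<in>T. x (g i))"
    by (simp_all add: add scale diff neg sum)
qed

lemma functionalD:
  assumes "functional \<phi>"
  shows "\<phi> (a + b) = \<phi> a + \<phi> b" "\<phi> (scale c a) = c * \<phi> a" "\<phi> 0 = 0"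
    "\<phi> (a - b) = \<phi> a - \<phi> b" "\<phi> (- a) = - \<phi> a" "\<phi> (sum g T) = (\<Sum>i\<in>T. \<phi> (g i))"
proof -
  interpret Vector_Spaces.linear scale "(*)" \<phi> by fact
  show "\<phi> (a + b) = \<phi> a + \<phi> b" "\<phi> (scale c a) = c * \<phi> a" "\<phi> 0 = 0"
    "\<phi> (a - b) = \<phi> a - \<phi> b" "\<phi> (- a) = - \<phi> a" "\<phi> (sum g T) = (\<Sum>i\<in>T. \<phi> (g i))"
    by (simp_all add: add scale diff neg sum)
qed

lemma vector_space_field: "vector_space ((*) :: 'a \<Rightarrow> 'a \<Rightarrow> 'a)"
  by unfold_locales (simp_all add: algebra_simps)

lemma endoI:
  assumes "\<And>a b. x (a + b) = x a + x b" "\<And>c a. x (scale c a) = scale c (x a)"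
  shows "endo x"
  by (rule vector_space_linearI) (use assms vector_space_axioms in auto)

lemma functionalI:
  assumes "\<And>a b. \<phi> (a + b) = \<phi> a + \<phi> b" "\<And>c a. \<phi> (scale c a) = c * \<phi> a"
  shows "functional \<phi>"
  by (rule vector_space_linearI) (use assms vector_space_axioms vector_space_field in auto)

lemma exists_functional:
  assumes "independent B"
  shows "\<exists>\<phi>. functional \<phi> \<and> (\<forall>b\<in>B. \<phi> b = f b)"
proof -
  interpret vector_space_pair scale "(*) :: 'a \<Rightarrow> 'a \<Rightarrow> 'a"
    using vector_space_axioms vector_space_field by (simp add: vector_space_pair_def)
  show ?thesis using linear_independent_extend[OF assms] .
qed

lemma exists_endo:
  assumes "independent B"
  shows "\<exists>x. endo x \<and> (\<forall>b\<in>B. x b = f b)"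
proof -
  interpret vector_space_pair scale scale
    using vector_space_axioms by (simp add: vector_space_pair_def)
  show ?thesis using linear_independent_extend[OF assms] .
qed

lemma endo_funpow:
  assumes x: "endo x"
  shows "endo (x ^^ k)"
proof (induction k)
  case (Suc k)
  show ?case by (rule endoI) (simp_all add: endoD[OF x] endoD[OF Suc])
qed (auto intro: endoI)

lemmas powD = endoD[OF endo_funpow]

lemma funpow_mem: "x ` W \<subseteq> W \<Longrightarrow> w \<in> W \<Longrightarrow> (x ^^ k) w \<in> W"
  by (induction k) auto

lemma funpow_add_apply: "(x ^^ k) ((x ^^ l) w) = (x ^^ (k + l)) w"
  by (simp add: funpow_add)

lemma funpow_zero_mono:
  assumes "endo x" "(x ^^ k) w = 0" "k \<le> l"
  shows "(x ^^ l) w = 0"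
proof -
  have "(x ^^ l) w = (x ^^ (l - k)) ((x ^^ k) w)"
    using assms(3) by (simp add: funpow_add_apply)
  then show ?thesis using assms by (simp add: powD[OF assms(1)])
qed

subsection \<open>Row generators\<close>

text \<open>Generation as a module over F[x]. Quantifying over invariant subspaces avoids
  polynomials in \<open>x\<close> and turns spanning claims into checks on the generators.\<close>

definition generates :: "('b \<Rightarrow> 'b) \<Rightarrow> 'b set \<Rightarrow> bool" where
  "generates x B \<longleftrightarrow> (\<forall>W. subspace W \<longrightarrow> x ` W \<subseteq> W \<longrightarrow> B \<subseteq> W \<longrightarrow> W = UNIV)"

text \<open>The relations only bound the orders of the generators. When the row lengths add up to
  \<open>dimension\<close>, counting makes the orders exact and the sum of the rows direct.\<close>

definition row_gens ::
  "nat \<Rightarrow> (nat \<Rightarrow> nat) \<Rightarrow> (nat \<Rightarrow> nat) \<Rightarrow> ('b \<Rightarrow> 'b) \<Rightarrow> 'b \<Rightarrow> (nat \<Rightarrow> 'b) \<Rightarrow> bool" where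
  "row_gens N p q x v w \<longleftrightarrow> endo x \<and> (\<forall>i<N. (x ^^ (p i + q i)) (w i) = 0) \<and>
    generates x (w ` {..<N}) \<and> v = (\<Sum>i<N. (x ^^ q i) (w i))"

definition row_orbit :: "nat \<Rightarrow> (nat \<Rightarrow> nat) \<Rightarrow> (nat \<Rightarrow> nat) \<Rightarrow> ('b \<times> ('b \<Rightarrow> 'b)) set" where
  "row_orbit N p q = {(v, x). \<exists>w. row_gens N p q x v w}"

lemma generates_eqI:
  fixes w :: "nat \<Rightarrow> 'b"
  assumes "generates x (w ` {..<N})" "subspace W" "x ` W \<subseteq> W" "\<And>i. i < N \<Longrightarrow> w i \<in> W"
  shows "u \<in> W"
proof -
  have "W = UNIV" using assms unfolding generates_def by blast
  then show ?thesis by simp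
qed

lemma subspace_pow_kernel:
  assumes "endo x"
  shows "subspace {u. (x ^^ k) u = 0}"
  by (rule subspaceI) (simp_all add: powD[OF assms])

text \<open>The kernel of a power of \<open>x\<close> is an invariant subspace, so it suffices to
  kill the generators; the sum of the exponents is just a common bound.\<close>

lemma generates_nilpotent:
  fixes w :: "nat \<Rightarrow> 'b"
  assumes x: "endo x" and gen: "generates x (w ` {..<N})"
    and kill: "\<And>i. i < N \<Longrightarrow> (x ^^ l i) (w i) = 0"
  shows "(x ^^ (\<Sum>i<N. l i)) u = 0"
proof -
  let ?K = "\<Sum>i<N. l i"
  have "u \<in> {u. (x ^^ ?K) u = 0}"
  proof (rule generates_eqI[OF gen])
    show "subspace {u. (x ^^ ?K) u = 0}" by (rule subspace_pow_kernel[OF x])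
    show "x ` {u. (x ^^ ?K) u = 0} \<subseteq> {u. (x ^^ ?K) u = 0}"
      using endoD(3)[OF x] by (auto simp: funpow_swap1[where f = x, symmetric])
    show "w i \<in> {u. (x ^^ ?K) u = 0}" if "i < N" for i
    proof -
      have "l i \<le> ?K" using that by (intro member_le_sum) auto
      then show ?thesis using funpow_zero_mono[OF x kill[OF that]] by simp
    qed
  qed
  then show ?thesis by simp
qed

lemma row_orbit_subset_cone: "row_orbit N p q \<subseteq> enhanced_cone scale"
proof (clarsimp simp: row_orbit_def enhanced_cone_def nilpotent_endos_def)
  fix v x w assume w: "row_gens N p q x v w"
  then show "endo x \<and> (\<exists>m. \<forall>u. (x ^^ m) u = 0)"
    using generates_nilpotent[of x w N "\<lambda>i. p i + q i"] by (auto simp: row_gens_def)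
qed

text \<open>An index \<open>(i, k)\<close> stands for \<open>x^k\<close> applied to the generator of
  row \<open>i\<close>, so exponents start at 0, unlike the second index of the basis
  \<open>e i j\<close>.\<close>

definition row_index :: "nat \<Rightarrow> (nat \<Rightarrow> nat) \<Rightarrow> (nat \<times> nat) set" where
  "row_index N l = (SIGMA i:{..<N}. {..<l i})"

lemma finite_row_index [simp]: "finite (row_index N l)"
  by (simp add: row_index_def)

lemma card_row_index: "card (row_index N l) = (\<Sum>i<N. l i)"
  by (simp add: row_index_def)

lemma indexed_spanning_basis:
  assumes "finite J" "card J = dimension" "span (g ` J) = UNIV"
  shows "inj_on g J" "independent (g ` J)"
proof -
  have "dim UNIV \<le> card (g ` J)"
    using assms by (intro span_card_ge_dim) auto
  moreover have le: "card (g ` J) \<le> card J" using assms(1) by (rule card_image_le)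
  ultimately have "card (g ` J) = card J"
    using assms(2) by (simp add: dim_UNIV dimension_def)
  then show "inj_on g J" using assms(1) by (simp add: eq_card_imp_inj_on)
  show "independent (g ` J)"
  proof (rule card_le_dim_spanning)
    show "card (g ` J) \<le> dim UNIV" using le assms(2) by (simp add: dim_UNIV dimension_def)
  qed (use assms in auto)
qed

text \<open>The span of the listed powers is invariant, since powers beyond a row vanish, and it
  contains the generators. Hence it is everything, and the count gives a basis.\<close>

lemma row_gens_basis:
  assumes w: "row_gens N p q x v w" and n: "(\<Sum>i<N. p i + q i) = dimension"
  defines "J \<equiv> row_index N (\<lambda>i. p i + q i)" and "g \<equiv> \<lambda>(i, k). (x ^^ k) (w i)"
  shows "span (g ` J) = UNIV" "inj_on g J" "independent (g ` J)"
proof -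
  have x: "endo x" using w by (simp add: row_gens_def)
  have "u \<in> span (g ` J)" for u
  proof (rule generates_eqI)
    show "generates x (w ` {..<N})" using w by (simp add: row_gens_def)
    have mem: "(x ^^ k) (w i) \<in> span (g ` J)" if "i < N" for i k
    proof (cases "k < p i + q i")
      case True
      then have "(i, k) \<in> J" using that by (simp add: J_def row_index_def)
      then have "g (i, k) \<in> g ` J" by blast
      then show ?thesis unfolding g_def by (simp add: span_base)
    next
      case False
      then have "(x ^^ k) (w i) = 0"
        using w that funpow_zero_mono[OF x, of "p i + q i"] by (auto simp: row_gens_def)
      then show ?thesis by (simp add: span_zero)
    qed
    then show "w i \<in> span (g ` J)" if "i < N" for i using mem[OF that, of 0] by simp
    have "x ` span (g ` J) = span (x ` g ` J)"
      using x by (simp add: linear_iff_module_hom module_hom.span_image)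
    also have "\<dots> \<subseteq> span (g ` J)"
    proof (rule span_minimal)
      show "x ` g ` J \<subseteq> span (g ` J)"
      proof clarify
        fix i k assume "(i, k) \<in> J"
        then have "(x ^^ Suc k) (w i) \<in> span (g ` J)" by (intro mem) (simp add: J_def row_index_def)
        then show "x (g (i, k)) \<in> span (g ` J)" by (simp add: g_def)
      qed
    qed simp
    finally show "x ` span (g ` J) \<subseteq> span (g ` J)" .
  qed simp
  then show s: "span (g ` J) = UNIV" by blast
  show "inj_on g J" "independent (g ` J)"
    using indexed_spanning_basis[OF _ _ s] n by (simp_all add: J_def card_row_index)
qed

text \<open>Coordinate functionals of the basis of powers. The exponent \<open>l\<close> is
  unrestricted, because beyond the end of a row both sides are 0.\<close>

lemma row_gens_dual:
  assumes w: "row_gens N p q x v w" and n: "(\<Sum>i<N. p i + q i) = dimension"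
    and "k < p i + q i" "i < N"
  obtains \<phi> where "functional \<phi>"
    "\<And>j l. j < N \<Longrightarrow> \<phi> ((x ^^ l) (w j)) = (if j = i \<and> l = k then 1 else 0)"
proof -
  let ?J = "row_index N (\<lambda>i. p i + q i)" and ?g = "\<lambda>(i, k). (x ^^ k) (w i)"
  note bs = row_gens_basis[OF w n]
  have x: "endo x" using w by (simp add: row_gens_def)
  obtain \<phi> where \<phi>: "functional \<phi>"
    "\<forall>b\<in>?g ` ?J. \<phi> b = (if the_inv_into ?J ?g b = (i, k) then 1 else 0)"
    using exists_functional[OF bs(3), of "\<lambda>b. if the_inv_into ?J ?g b = (i, k) then 1 else 0"]
    by (elim exE conjE)
  have "\<phi> ((x ^^ l) (w j)) = (if j = i \<and> l = k then 1 else 0)" if "j < N" for j l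
  proof (cases "l < p j + q j")
    case True
    then have J: "(j, l) \<in> ?J" using that by (simp add: row_index_def)
    then have "\<phi> (?g (j, l)) = (if the_inv_into ?J ?g (?g (j, l)) = (i, k) then 1 else 0)"
      using \<phi>(2) by blast
    then show ?thesis using the_inv_into_f_f[OF bs(2) J] by simp
  next
    case False
    then have "(x ^^ l) (w j) = 0"
      using w that funpow_zero_mono[OF x, of "p j + q j"] by (auto simp: row_gens_def)
    then show ?thesis using False assms(3) functionalD(3)[OF \<phi>(1)] by auto
  qed
  with \<phi>(1) show ?thesis using that by blast
qed

text \<open>As \<open>x\<close> acts nilpotently on \<open>y\<close>, \<open>t + c x^(k + 1)\<close>
  acts as a unit there. Descending induction recovers each \<open>x^j y\<close> from higher powers
  already known to lie in \<open>W\<close>.\<close>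

lemma nilpotent_unit_mem:
  assumes x: "endo x" and nil: "(x ^^ m) y = 0"
    and W: "subspace W" "x ` W \<subseteq> W" and t: "t \<noteq> 0"
    and mem: "scale t y + scale c ((x ^^ Suc k) y) \<in> W"
  shows "y \<in> W"
proof -
  have "(x ^^ j) y \<in> W" for j
  proof (induction "m - j" arbitrary: j rule: less_induct)
    case less
    show ?case
    proof (cases "j < m")
      case True
      have "(x ^^ (j + Suc k)) y \<in> W" by (rule less) (use True in simp)
      moreover have "(x ^^ j) (scale t y + scale c ((x ^^ Suc k) y)) \<in> W"
        by (rule funpow_mem[OF W(2) mem])
      then have "scale t ((x ^^ j) y) + scale c ((x ^^ (j + Suc k)) y) \<in> W"
        by (simp only: powD[OF x] funpow_add_apply)
      ultimately have "scale t ((x ^^ j) y) + scale c ((x ^^ (j + Suc k)) y)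
          - scale c ((x ^^ (j + Suc k)) y) \<in> W"
        by (intro subspace_diff subspace_scale W(1))
      then have "scale t ((x ^^ j) y) \<in> W" by (simp only: add_diff_cancel_right')
      then have "scale (inverse t) (scale t ((x ^^ j) y)) \<in> W"
        using W(1) by (rule subspace_scale[rotated])
      then show ?thesis using t by simp
    next
      case False
      then have "(x ^^ j) y = 0" using funpow_zero_mono[OF x nil] by simp
      then show ?thesis using W(1) by (simp add: subspace_0)
    qed
  qed
  from this[of 0] show ?thesis by simp
qed

text \<open>Injectivity is the unit argument above with \<open>W = {0}\<close>; finite dimension
  then gives surjectivity.\<close>

lemma nilpotent_unit_solve:
  assumes x: "endo x" and nil: "\<And>u. (x ^^ m) u = 0" and t: "t \<noteq> 0"
  shows "scale t y + x y = 0 \<Longrightarrow> y = 0" "\<exists>y. scale t y + x y = z"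
proof -
  have *: "y = 0" if "scale t y + x y = 0" for y
  proof -
    have "scale t y + scale 1 ((x ^^ Suc 0) y) \<in> {0}" using that by simp
    then have "y \<in> {0}"
      by (rule nilpotent_unit_mem[OF x nil _ _ t, rotated 2]) (simp_all add: endoD(3)[OF x])
    then show ?thesis by simp
  qed
  then show "scale t y + x y = 0 \<Longrightarrow> y = 0" .
  let ?u = "\<lambda>y. scale t y + x y"
  have u: "endo ?u" by (intro endoI) (simp_all add: endoD[OF x] algebra_simps)
  have "inj ?u"
  proof (rule injI)
    fix a b assume "?u a = ?u b"
    then have "?u (a - b) = 0" by (simp only: endoD(4)[OF u] diff_self)
    from *[OF this] show "a = b" by simp
  qed
  then have "surj ?u" using linear_inj_imp_surj[OF u] by blast
  then obtain y where "z = ?u y" by (rule surjE)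
  then show "\<exists>y. scale t y + x y = z" by (intro exI) (rule sym)
qed

subsection \<open>Degenerations along lines\<close>

lemma zariski_closureI:
  assumes "p \<in> enhanced_cone scale" "S \<subseteq> enhanced_cone scale"
    and "\<And>f. f \<in> poly_funs scale \<Longrightarrow> (\<And>s. s \<in> S \<Longrightarrow> f s = 0) \<Longrightarrow> f p = 0"
  shows "p \<in> zariski scale closure_of S"
  unfolding in_closure_of topspace_zariski openin_zariski
proof (intro conjI allI impI)
  fix T assume "p \<in> T \<and> (\<exists>P\<subseteq>poly_funs scale. T = enhanced_cone scale - zero_locus scale P)"
  then obtain P where P: "P \<subseteq> poly_funs scale" "T = enhanced_cone scale - zero_locus scale P" "p \<in> T"
    by blast
  then obtain f where f: "f \<in> P" "f p \<noteq> 0" by (auto simp: zero_locus_def)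
  with P(1) assms(3) obtain s where s: "s \<in> S" "f s \<noteq> 0" by blast
  then have "s \<in> T" using P(2) f(1) assms(2) by (auto simp: zero_locus_def)
  with s show "\<exists>y. y \<in> S \<and> y \<in> T" by blast
qed (use assms in auto)

lemma zariski_closureD:
  assumes "p \<in> zariski scale closure_of S" "f \<in> poly_funs scale" "f p \<noteq> 0"
  shows "\<exists>s\<in>S. f s \<noteq> 0"
proof -
  let ?T = "enhanced_cone scale - zero_locus scale {f}"
  have "p \<in> enhanced_cone scale" using assms(1) by (simp add: in_closure_of topspace_zariski)
  then have "p \<in> ?T" using assms(3) by (simp add: zero_locus_def)
  moreover have "openin (zariski scale) ?T"
    unfolding openin_zariski using assms(2) by blast
  ultimately obtain s where "s \<in> S" "s \<in> ?T" using assms(1) unfolding in_closure_of by meson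
  then show ?thesis by (auto simp: zero_locus_def)
qed

text \<open>The generating functions are affine in \<open>t\<close> along the line, and sums and
  products of polynomials in \<open>t\<close> are polynomials.\<close>

lemma poly_fun_on_line:
  assumes "f \<in> poly_funs scale"
  shows "\<exists>P. \<forall>t. f (v + scale t v1, \<lambda>u. x u + scale t (x1 u)) = poly P t"
  using assms
proof induction
  case (const c)
  show ?case by (intro exI[of _ "[:c:]"]) simp
next
  case (vector_coord \<phi>)
  show ?case by (intro exI[of _ "[:\<phi> v, \<phi> v1:]"]) (simp add: functionalD[OF vector_coord])
next
  case (matrix_coeff \<phi> w)
  show ?case by (intro exI[of _ "[:\<phi> (x w), \<phi> (x1 w):]"]) (simp add: functionalD[OF matrix_coeff])
next
  case (add f g)
  then obtain P Q where
    "\<forall>t. f (v + scale t v1, \<lambda>u. x u + scale t (x1 u)) = poly P t"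
    "\<forall>t. g (v + scale t v1, \<lambda>u. x u + scale t (x1 u)) = poly Q t" by blast
  then show ?case by (intro exI[of _ "P + Q"]) simp
next
  case (mult f g)
  then obtain P Q where
    "\<forall>t. f (v + scale t v1, \<lambda>u. x u + scale t (x1 u)) = poly P t"
    "\<forall>t. g (v + scale t v1, \<lambda>u. x u + scale t (x1 u)) = poly Q t" by blast
  then show ?case by (intro exI[of _ "P * Q"]) simp
qed

text \<open>A polynomial in \<open>t\<close> with infinitely many zeros is zero, so vanishing for
  \<open>t \<noteq> 0\<close> forces vanishing at \<open>t = 0\<close>.\<close>

lemma closure_of_line:
  assumes inf: "infinite (UNIV :: 'a set)"
    and "(v, x) \<in> enhanced_cone scale" "S \<subseteq> enhanced_cone scale"
    and line: "\<And>t. t \<noteq> 0 \<Longrightarrow> (v + scale t v1, \<lambda>u. x u + scale t (x1 u)) \<in> S"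
  shows "(v, x) \<in> zariski scale closure_of S"
proof (rule zariski_closureI)
  fix f assume f: "f \<in> poly_funs scale" "\<And>s. s \<in> S \<Longrightarrow> f s = 0"
  obtain P where P: "\<And>t. f (v + scale t v1, \<lambda>u. x u + scale t (x1 u)) = poly P t"
    using poly_fun_on_line[OF f(1)] by blast
  have "poly P t = 0" if "t \<noteq> 0" for t using P[of t] f(2)[OF line[OF that]] by simp
  then have "UNIV - {0} \<subseteq> {t. poly P t = 0}" by blast
  moreover have "infinite (UNIV - {0 :: 'a})" using inf by simp
  ultimately have "infinite {t. poly P t = 0}" using finite_subset by blast
  then have "P = 0" using poly_roots_finite by blast
  then show "f (v, x) = 0" using P[of 0] by simp
qed (use assms in auto)

definition row_closure :: "nat \<Rightarrow> (nat \<Rightarrow> nat) \<Rightarrow> (nat \<Rightarrow> nat) \<Rightarrow> ('b \<times> ('b \<Rightarrow> 'b)) set" where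
  "row_closure N p q = zariski scale closure_of row_orbit N p q"

lemma row_orbit_subset_closure: "row_orbit N p q \<subseteq> row_closure N p q"
  unfolding row_closure_def
  by (rule closure_of_subset) (simp add: topspace_zariski row_orbit_subset_cone)

lemma row_closure_trans:
  assumes "row_orbit N p q \<subseteq> row_closure N p' q'" "row_orbit N p' q' \<subseteq> row_closure N p'' q''"
  shows "row_orbit N p q \<subseteq> row_closure N p'' q''"
  using assms unfolding row_closure_def
  by (meson closedin_closure_of closure_of_minimal order_trans)

text \<open>The line may depend on the point and on its generators \<open>w\<close>; the point
  itself sits at \<open>t = 0\<close>.\<close>

lemma row_closureI:
  assumes inf: "infinite (UNIV :: 'a set)"
    and "\<And>v x w. row_gens N p' q' x v w \<Longrightarrow> \<exists>v1 x1. \<forall>t. t \<noteq> 0 \<longrightarrow>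
      (\<exists>w'. row_gens N p q (\<lambda>u. x u + scale t (x1 u)) (v + scale t v1) w')"
  shows "row_orbit N p' q' \<subseteq> row_closure N p q"
proof clarify
  fix v x assume vx: "(v, x) \<in> row_orbit N p' q'"
  then obtain w where w: "row_gens N p' q' x v w" by (auto simp: row_orbit_def)
  obtain v1 x1 where l: "\<forall>t. t \<noteq> 0 \<longrightarrow>
      (\<exists>w'. row_gens N p q (\<lambda>u. x u + scale t (x1 u)) (v + scale t v1) w')"
    using assms(2)[OF w] by blast
  show "(v, x) \<in> row_closure N p q"
    unfolding row_closure_def
  proof (rule closure_of_line[OF inf])
    show "(v, x) \<in> enhanced_cone scale" using vx row_orbit_subset_cone by blast
    show "row_orbit N p q \<subseteq> enhanced_cone scale" by (rule row_orbit_subset_cone)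
    show "(v + scale t v1, \<lambda>u. x u + scale t (x1 u)) \<in> row_orbit N p q" if "t \<noteq> 0" for t
      using l that by (simp add: row_orbit_def)
  qed
qed

lemma row_gensI:
  assumes "endo x" "\<And>i. i < N \<Longrightarrow> (x ^^ (p i + q i)) (w i) = 0"
    and "\<And>W u. subspace W \<Longrightarrow> x ` W \<subseteq> W \<Longrightarrow> (\<And>i. i < N \<Longrightarrow> w i \<in> W) \<Longrightarrow> u \<in> W"
    and "v = (\<Sum>i<N. (x ^^ q i) (w i))"
  shows "row_gens N p q x v w"
  unfolding row_gens_def generates_def
proof (intro conjI allI impI)
  fix W assume "subspace W" "x ` W \<subseteq> W" "w ` {..<N} \<subseteq> W"
  then have "u \<in> W" for u using assms(3)[of W u] by blast
  then show "W = UNIV" by blast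
qed (use assms in simp_all)

subsection \<open>Moving boxes between rows\<close>

text \<open>\<open>x\<close> stays fixed and \<open>v\<close> moves. In each row with
  \<open>p' i < p i\<close> a unit multiple of the generator is chosen whose image under
  \<open>x^(q i)\<close> is the old term plus \<open>t\<close> times a new one.\<close>

lemma row_drop:
  assumes inf: "infinite (UNIV :: 'a set)"
    and pq: "\<And>i. i < N \<Longrightarrow> p' i \<le> p i \<and> p' i + q' i = p i + q i"
  shows "row_orbit N p' q' \<subseteq> row_closure N p q"
proof (rule row_closureI[OF inf])
  fix v x w assume w: "row_gens N p' q' x v w"
  then have x: "endo x" and kill: "\<And>i. i < N \<Longrightarrow> (x ^^ (p' i + q' i)) (w i) = 0"
    and gen: "generates x (w ` {..<N})" and v: "v = (\<Sum>i<N. (x ^^ q' i) (w i))"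
    by (auto simp: row_gens_def)
  define v1 where "v1 = (\<Sum>i<N. if p' i < p i then (x ^^ q i) (w i) else 0)"
  have "\<exists>w'. row_gens N p q x (v + scale t v1) w'" if t: "t \<noteq> 0" for t
  proof (intro exI row_gensI[OF x])
    \<comment> \<open>Rows with \<open>p' i = p i\<close> keep their generator: the general formula
      would give \<open>scale (t + 1) (w i)\<close>, which vanishes at
      \<open>t = -1\<close>.\<close>
    let ?w' = "\<lambda>i. if p' i < p i then scale t (w i) + (x ^^ (p i - p' i)) (w i) else w i"
    show "(x ^^ (p i + q i)) (?w' i) = 0" if "i < N" for i
    proof -
      have z: "(x ^^ l) (w i) = 0" if "p i + q i \<le> l" for l
        using funpow_zero_mono[OF x kill[OF \<open>i < N\<close>]] pq[OF \<open>i < N\<close>] that by auto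
      show ?thesis by (simp add: powD[OF x] funpow_add_apply z)
    qed
    show "u \<in> W" if W: "subspace W" "x ` W \<subseteq> W" and mem: "\<And>i. i < N \<Longrightarrow> ?w' i \<in> W" for W u
    proof (rule generates_eqI[OF gen W])
      fix i assume i: "i < N"
      show "w i \<in> W"
      proof (cases "p' i < p i")
        case True
        then have "scale t (w i) + scale 1 ((x ^^ Suc (p i - p' i - 1)) (w i)) \<in> W"
          using mem[OF i] by (simp add: Suc_diff_Suc)
        then show ?thesis by (rule nilpotent_unit_mem[OF x kill[OF i] W t])
      qed (use mem[OF i] in simp)
    qed
    have "(x ^^ q i) (?w' i) = (x ^^ q' i) (w i) + scale t (if p' i < p i then (x ^^ q i) (w i) else 0)"
      if "i < N" for i
    proof -
      have "q i + (p i - p' i) = q' i" using pq[OF that] by linarith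
      then show ?thesis using pq[OF that] by (auto simp: powD[OF x] funpow_add_apply)
    qed
    then show "v + scale t v1 = (\<Sum>i<N. (x ^^ q i) (?w' i))"
      by (simp add: v v1_def scale_sum_right sum.distrib)
  qed
  then show "\<exists>v1 x1. \<forall>t. t \<noteq> 0 \<longrightarrow>
      (\<exists>w'. row_gens N p q (\<lambda>u. x u + scale t (x1 u)) (v + scale t v1) w')"
    by (intro exI[of _ v1] exI[of _ "\<lambda>_. 0"]) simp
qed

lemma sum_split_two:
  fixes i j N :: nat
  assumes "i < N" "j < N" "i \<noteq> j"
  shows "(\<Sum>k<N. F k) = F i + F j + (\<Sum>k\<in>{..<N} - {i, j}. F k :: 'c :: comm_monoid_add)"
proof -
  have "(\<Sum>k<N. F k) = F i + (\<Sum>k\<in>{..<N} - {i}. F k)"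
    using assms by (intro sum.remove) auto
  also have "(\<Sum>k\<in>{..<N} - {i}. F k) = F j + (\<Sum>k\<in>{..<N} - {i} - {j}. F k)"
    using assms by (intro sum.remove) auto
  also have "{..<N} - {i} - {j} = {..<N} - {i, j}" by blast
  finally show ?thesis by (simp add: add.assoc)
qed

text \<open>The point \<open>(v, x)\<close> stays the same: the new \<open>w i\<close> absorbs the
  difference between the old and the new term of row \<open>j\<close> in \<open>v\<close>. The
  bounds \<open>p j \<le> p i\<close> and \<open>a \<le> p i\<close> ensure that
  \<open>x^(p i + q i)\<close> still kills it.\<close>

lemma row_absorb:
  assumes ij: "i < N" "j < N" "i \<noteq> j"
    and "p j \<le> p i" "q i \<le> q j" "a \<le> p i" "q i \<le> b" "a + b = p j + q j"
  shows "row_orbit N p q \<subseteq> row_orbit N (p(j := a)) (q(j := b))"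
proof clarify
  fix v x assume "(v, x) \<in> row_orbit N p q"
  then obtain w where "row_gens N p q x v w" by (auto simp: row_orbit_def)
  then have x: "endo x" and kill: "\<And>i. i < N \<Longrightarrow> (x ^^ (p i + q i)) (w i) = 0"
    and gen: "generates x (w ` {..<N})" and v: "v = (\<Sum>i<N. (x ^^ q i) (w i))"
    by (auto simp: row_gens_def)
  have z: "(x ^^ l) (w j) = 0" if "p j + q j \<le> l" for l
    using funpow_zero_mono[OF x kill[OF ij(2)] that] .
  let ?w' = "w(i := w i + (x ^^ (q j - q i)) (w j) - (x ^^ (b - q i)) (w j))"
  have "row_gens N (p(j := a)) (q(j := b)) x v ?w'"
  proof (rule row_gensI[OF x])
    show "(x ^^ ((p(j := a)) k + (q(j := b)) k)) (?w' k) = 0" if "k < N" for k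
    proof (cases "k = i")
      case True
      have "p j + q j \<le> p i + q i + (q j - q i)" "p j + q j \<le> p i + q i + (b - q i)"
        using assms by simp_all
      then show ?thesis using True ij by (simp add: powD[OF x] funpow_add_apply z kill)
    qed (use that assms kill in auto)
    show "u \<in> W" if W: "subspace W" "x ` W \<subseteq> W" and mem: "\<And>k. k < N \<Longrightarrow> ?w' k \<in> W" for W u
    proof (rule generates_eqI[OF gen W])
      fix k assume k: "k < N"
      have wj: "w j \<in> W" using mem[OF ij(2)] ij by simp
      have "?w' i - (x ^^ (q j - q i)) (w j) + (x ^^ (b - q i)) (w j) \<in> W"
        by (intro subspace_add subspace_diff funpow_mem W wj mem ij)
      then have "w i \<in> W" by simp
      then show "w k \<in> W" using mem[OF k] by (cases "k = i") auto
    qed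
    have "q i + (q j - q i) = q j" "q i + (b - q i) = b" using assms by simp_all
    then have "(x ^^ q i) (?w' i) = (x ^^ q i) (w i) + (x ^^ q j) (w j) - (x ^^ b) (w j)"
      by (simp add: powD[OF x] funpow_add_apply)
    then show "v = (\<Sum>k<N. (x ^^ (q(j := b)) k) (?w' k))"
      unfolding v sum_split_two[OF ij] using ij by (simp add: algebra_simps)
  qed
  then show "(v, x) \<in> row_orbit N (p(j := a)) (q(j := b))" by (auto simp: row_orbit_def)
qed

lemma row_absorb_set:
  assumes "finite M" "M \<subseteq> {..<N}" "i < N" "i \<notin> M"
    and "\<And>j. j \<in> M \<Longrightarrow> p j \<le> p i \<and> q i \<le> q j \<and> a j \<le> p i \<and> q i \<le> b j \<and> a j + b j = p j + q j"
  shows "row_orbit N p q \<subseteq> row_orbit N (\<lambda>j. if j \<in> M then a j else p j) (\<lambda>j. if j \<in> M then b j else q j)"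
  using assms
proof (induction M)
  case (insert m M)
  let ?p = "\<lambda>j. if j \<in> M then a j else p j" and ?q = "\<lambda>j. if j \<in> M then b j else q j"
  have "row_orbit N p q \<subseteq> row_orbit N ?p ?q"
    by (rule insert.IH) (use insert.prems in auto)
  also have "\<dots> \<subseteq> row_orbit N (?p(m := a m)) (?q(m := b m))"
    by (rule row_absorb[of i]) (use insert.prems insert.hyps in auto)
  finally have "row_orbit N p q \<subseteq> row_orbit N (?p(m := a m)) (?q(m := b m))" .
  moreover have "?p(m := a m) = (\<lambda>j. if j \<in> insert m M then a j else p j)"
    "?q(m := b m) = (\<lambda>j. if j \<in> insert m M then b j else q j)" by auto
  ultimately show ?case by (simp only:)
qed simp

lemma endo_rank_one_update:
  assumes "endo x" "functional \<phi>"
  shows "endo (\<lambda>u. x u + scale t (scale (\<phi> u) y))"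
  by (rule endoI) (simp_all add: endoD[OF assms(1)] functionalD[OF assms(2)] algebra_simps)

text \<open>Makes the deformations computable: choosing \<open>\<phi>\<close> to vanish on selected
  rows leaves the powers on these rows unchanged.\<close>

lemma funpow_rank_one_update:
  assumes "\<And>k. k < l \<Longrightarrow> \<phi> ((x ^^ k) u) = 0"
  shows "((\<lambda>u. x u + scale t (scale (\<phi> u) y)) ^^ l) u = (x ^^ l) u"
  using assms by (induction l) auto

text \<open>Transfers generation: once a subspace invariant under the deformed map contains the
  direction \<open>y\<close>, it can be tested with the old generators.\<close>

lemma rank_one_update_invariant:
  assumes "subspace W" "(\<lambda>u. x u + scale t (scale (\<phi> u) y)) ` W \<subseteq> W" "y \<in> W"
  shows "x ` W \<subseteq> W"
proof clarify
  fix u assume "u \<in> W"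
  then have "x u + scale t (scale (\<phi> u) y) - scale t (scale (\<phi> u) y) \<in> W"
    using assms by (intro subspace_diff subspace_scale) auto
  then show "x u \<in> W" by simp
qed

text \<open>At the limit, row \<open>i\<close> is one box shorter and row \<open>j\<close> one box
  longer. The deformation sends \<open>w j\<close> to \<open>x (w j) + scale t (w i)\<close>, so
  \<open>w j\<close> produces the longer row \<open>i\<close>, and \<open>x (w j)\<close> is left
  over for row \<open>j\<close>.\<close>

lemma row_move_second:
  assumes inf: "infinite (UNIV :: 'a set)"
    and n: "(\<Sum>k<N. p k + q k) = dimension"
    and ij: "i < N" "j < N" "i \<noteq> j"
    and c: "q j + 2 \<le> q i" "p j + q j < p i + q i"
  shows "row_orbit N p (q(i := q i - 1, j := q j + 1)) \<subseteq> row_closure N p q"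
proof (rule row_closureI[OF inf])
  let ?q = "q(i := q i - 1, j := q j + 1)"
  fix v x w assume w: "row_gens N p ?q x v w"
  then have x: "endo x" and kill: "\<And>k. k < N \<Longrightarrow> (x ^^ (p k + ?q k)) (w k) = 0"
    and gen: "generates x (w ` {..<N})" and v: "v = (\<Sum>k<N. (x ^^ ?q k) (w k))"
    by (auto simp: row_gens_def)
  have n': "(\<Sum>k<N. p k + ?q k) = dimension"
    using n c ij(3) unfolding sum_split_two[OF ij] by simp
  obtain \<phi> where \<phi>: "functional \<phi>"
    and dual: "\<And>k l. k < N \<Longrightarrow> \<phi> ((x ^^ l) (w k)) = (if k = j \<and> l = 0 then 1 else 0)"
    using row_gens_dual[OF w n', of 0 j] ij by auto
  have zf: "(x ^^ l) (w i) = 0" if "p i + q i \<le> Suc l" for l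
    using funpow_zero_mono[OF x kill[OF ij(1)]] that ij c by auto
  have zg: "(x ^^ l) (w j) = 0" if "p j + q j < l" for l
    using funpow_zero_mono[OF x kill[OF ij(2)]] that by auto
  \<comment> \<open>The gap of at least 2 makes \<open>x^(q i - q j) (w j)\<close> a positive power
    of \<open>x\<close> applied to \<open>x (w j)\<close>, so the new generator of row
    \<open>j\<close> is a unit multiple of \<open>x (w j)\<close>.\<close>
  obtain m where m: "q i - q j = Suc (Suc m)" using c that[of "q i - q j - 2"] by simp
  have "\<exists>w'. row_gens N p q (\<lambda>u. x u + scale t (scale (\<phi> u) (w i))) v w'" if t: "t \<noteq> 0" for t
  proof -
    define X where "X = (\<lambda>u. x u + scale t (scale (\<phi> u) (w i)))"
    have X: "endo X" unfolding X_def by (rule endo_rank_one_update[OF x \<phi>])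
    have Xw: "(X ^^ l) (w k) = (x ^^ l) (w k)" if "k < N" "k \<noteq> j" for k l
      unfolding X_def by (rule funpow_rank_one_update) (simp add: dual that)
    have Xxg: "(X ^^ l) ((x ^^ Suc s) (w j)) = (x ^^ (l + Suc s)) (w j)" for l s
      unfolding X_def
      by (subst funpow_rank_one_update) (simp_all only: funpow_add_apply dual[OF ij(2)], simp)
    have Xg1: "X (w j) = x (w j) + scale t (w i)"
      using dual[OF ij(2), of 0] by (simp add: X_def)
    have Xg: "(X ^^ Suc l) (w j) = (x ^^ Suc l) (w j) + scale t ((x ^^ l) (w i))" for l
      using Xxg[of l 0] Xw[OF ij(1,3), of l]
      by (simp add: funpow_swap1 Xg1 powD[OF X])
    \<comment> \<open>The correction in row \<open>j\<close> cancels the multiple of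
      \<open>x^(q i) (w j)\<close> that the new row \<open>i\<close> adds to
      \<open>v\<close>.\<close>
    let ?w' = "w(i := scale (inverse t) (w j), j := x (w j) - scale (inverse t) ((x ^^ (q i - q j)) (w j)))"
    have "row_gens N p q X v ?w'"
    proof (rule row_gensI[OF X])
      show "(X ^^ (p k + q k)) (?w' k) = 0" if "k < N" for k
      proof -
        obtain l where l: "p i + q i = Suc l" using c that[of "p i + q i - 1"] by simp
        consider "k = i" | "k = j" | "k \<noteq> i" "k \<noteq> j" by blast
        then show "(X ^^ (p k + q k)) (?w' k) = 0"
        proof cases
          case 1
          have "(X ^^ (p i + q i)) (w j) = 0"
            unfolding l Xg using c l zf[of l] zg[of "Suc l"] by simp
          then show ?thesis using 1 ij by (simp add: powD[OF X])
        next
          case 2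
          have "(X ^^ (p j + q j)) (x (w j)) = 0" using Xxg[of _ 0] zg[of "Suc (p j + q j)"] by simp
          then show ?thesis using 2 Xxg[of _ "Suc m"] zg[of "Suc (Suc (p j + q j + m))"] by (simp add: powD[OF X] m)
        next
          case 3
          then show ?thesis using Xw[OF that] kill[OF that] by simp
        qed
      qed
      show "u \<in> W" if W: "subspace W" "X ` W \<subseteq> W"
        and mem: "\<And>k. k < N \<Longrightarrow> ?w' k \<in> W" for W u
      proof (rule generates_eqI[OF gen W(1)])
        have "scale t (?w' i) \<in> W" by (intro subspace_scale W mem ij)
        then have g: "w j \<in> W" using t ij by simp
        have "scale 1 (x (w j)) + scale (- inverse t) ((X ^^ Suc m) (x (w j))) \<in> W"
          using mem[OF ij(2)] ij Xxg[of "Suc m" 0] by (simp add: m)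
        then have xg: "x (w j) \<in> W"
          by (rule nilpotent_unit_mem[OF X _ W(1) W(2), rotated 2])
            (use Xxg[of "p j + q j" 0] zg[of "Suc (p j + q j)"] in simp_all)
        have "scale (inverse t) (X (w j) - x (w j)) \<in> W"
          using W(2) g by (intro subspace_scale subspace_diff W xg) auto
        then have f: "w i \<in> W" using t by (simp add: Xg1)
        show "x ` W \<subseteq> W" by (rule rank_one_update_invariant[OF W[unfolded X_def] f])
        show "w k \<in> W" if "k < N" for k using mem[OF that] f g by (cases "k = i \<or> k = j") auto
      qed
      obtain l where l: "q i = Suc l" using c that[of "q i - 1"] by simp
      have "(X ^^ q i) (?w' i) = scale (inverse t) ((x ^^ q i) (w j)) + (x ^^ (q i - 1)) (w i)"
        using ij Xg[of l] t by (simp add: l powD[OF X] endoD[OF X] algebra_simps)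
      moreover have "(X ^^ q j) (?w' j) = (x ^^ (q j + 1)) (w j) - scale (inverse t) ((x ^^ q i) (w j))"
      proof -
        have "q j + Suc (Suc m) = q i" using m by simp
        then show ?thesis
          using ij Xxg[of "q j" "Suc m"] Xxg[of "q j" 0] by (simp add: m powD[OF X])
      qed
      moreover have "(\<Sum>k\<in>{..<N} - {i, j}. (X ^^ q k) (?w' k)) = (\<Sum>k\<in>{..<N} - {i, j}. (x ^^ q k) (w k))"
        by (rule sum.cong) (auto simp: Xw)
      ultimately show "v = (\<Sum>k<N. (X ^^ q k) (?w' k))"
        unfolding v sum_split_two[OF ij] using ij by (simp add: algebra_simps)
    qed
    then show ?thesis unfolding X_def by blast
  qed
  then show "\<exists>v1 x1. \<forall>t. t \<noteq> 0 \<longrightarrow>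
      (\<exists>w'. row_gens N p q (\<lambda>u. x u + scale t (x1 u)) (v + scale t v1) w')"
    by (intro exI[of _ 0] exI[of _ "\<lambda>u. scale (\<phi> u) (w i)"]) simp
qed


lemma row_move_second_first:
  assumes inf: "infinite (UNIV :: 'a set)"
    and n: "(\<Sum>k<N. p k + q k) = dimension"
    and ij: "i < N" "j < N" "i \<noteq> j"
    and c: "p j < p i" "q j < q i"
  shows "row_orbit N (p(j := p j + 1)) (q(i := q i - 1)) \<subseteq> row_closure N p q"
proof (rule row_closureI[OF inf])
  let ?p = "p(j := p j + 1)" and ?q = "q(i := q i - 1)"
  fix v x w assume w: "row_gens N ?p ?q x v w"
  then have x: "endo x" and kill: "\<And>k. k < N \<Longrightarrow> (x ^^ (?p k + ?q k)) (w k) = 0"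
    and gen: "generates x (w ` {..<N})" and v: "v = (\<Sum>k<N. (x ^^ ?q k) (w k))"
    by (auto simp: row_gens_def)
  have n': "(\<Sum>k<N. ?p k + ?q k) = dimension"
    using n c ij(3) unfolding sum_split_two[OF ij] by simp
  \<comment> \<open>At the limit row \<open>i\<close> has length \<open>s + a\<close> and row
    \<open>j\<close> has length \<open>b + 1\<close>. Since \<open>a = r + b\<close>, shifting row
    \<open>i\<close> by \<open>x^r\<close> puts \<open>x^a (w i)\<close> level with
    \<open>x^b (w j)\<close>, the last nonzero vector of row \<open>j\<close>.\<close>
  define a where "a = p j + q i - 1"
  define b where "b = p j + q j"
  define r where "r = q i - 1 - q j"
  define s where "s = p i - p j"
  have a: "a = r + b" "p j + q i = Suc a" "p i + q i = s + Suc a" "s > 0" "p j + (q i - 1) = a"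
    and r: "r + q j = q i - 1"
    using c by (simp_all add: a_def b_def r_def s_def)
  obtain \<phi>1 where \<phi>1: "functional \<phi>1"
    and dual1: "\<And>k l. k < N \<Longrightarrow> \<phi>1 ((x ^^ l) (w k)) = (if k = i \<and> l = a then 1 else 0)"
    using row_gens_dual[OF w n', of a i] ij a by auto
  obtain \<phi>2 where \<phi>2: "functional \<phi>2"
    and dual2: "\<And>k l. k < N \<Longrightarrow> \<phi>2 ((x ^^ l) (w k)) = (if k = j \<and> l = b then 1 else 0)"
    using row_gens_dual[OF w n', of b j] ij by (auto simp: b_def)
  \<comment> \<open>\<open>\<phi>1\<close> takes the value 1 at \<open>x^b d\<close> for the vector
    \<open>d\<close> below; subtracting \<open>\<phi>2\<close> cancels it, so the powers on
    \<open>d\<close> stay undisturbed.\<close>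
  define \<phi> where "\<phi> = (\<lambda>u. \<phi>1 u - \<phi>2 u)"
  have \<phi>: "functional \<phi>"
    by (rule functionalI) (simp_all add: \<phi>_def functionalD[OF \<phi>1] functionalD[OF \<phi>2] algebra_simps)
  have zf: "(x ^^ l) (w i) = 0" if "s + a \<le> l" for l
    using funpow_zero_mono[OF x kill[OF ij(1)]] that ij a by auto
  have zg: "(x ^^ l) (w j) = 0" if "b < l" for l
    using funpow_zero_mono[OF x kill[OF ij(2)]] that ij by (auto simp: b_def)
  \<comment> \<open>Chosen so that \<open>x^(q j) d\<close> is the component of \<open>v\<close> in
    the two rows.\<close>
  define d where "d = w j + (x ^^ r) (w i)"
  have xd: "(x ^^ l) d = (x ^^ l) (w j) + (x ^^ (l + r)) (w i)" for l
    by (simp add: d_def powD[OF x] funpow_add_apply)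
  have \<phi>d: "\<phi> ((x ^^ l) d) = 0" for l
    unfolding xd \<phi>_def
    by (simp add: functionalD[OF \<phi>1] functionalD[OF \<phi>2] dual1 dual2 ij ij(3)[symmetric] a)
  define y where "y = (x ^^ b) d"
  \<comment> \<open>The functional \<open>\<phi>\<close> vanishes on the submodule generated by \<open>d\<close>, which contains \<open>y\<close> and the
    component of \<open>v\<close> in the two rows.  Hence the deformation \<open>X\<close> only changes the relation
    \<open>x^(a + 1) w\<^sub>i = x y\<close>, into \<open>X^(a + 1) w\<^sub>i = X y + t y\<close>.  The new generators are
    \<open>(X + t)^-1 w\<^sub>i\<close> and \<open>d - (X + t)^-1 X^(q\<^sub>i - q\<^sub>j) w\<^sub>i\<close>.\<close>
  have "\<exists>w'. row_gens N p q (\<lambda>u. x u + scale t (scale (\<phi> u) y)) v w'" if t: "t \<noteq> 0" for t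
  proof -
    define X where "X = (\<lambda>u. x u + scale t (scale (\<phi> u) y))"
    have X: "endo X" unfolding X_def by (rule endo_rank_one_update[OF x \<phi>])
    have Xw: "(X ^^ l) (w k) = (x ^^ l) (w k)" if "k < N" "k \<noteq> i" "k \<noteq> j" for k l
      unfolding X_def
      by (rule funpow_rank_one_update)
        (simp add: \<phi>_def dual1 dual2 that)
    have Xd: "(X ^^ l) ((x ^^ m) d) = (x ^^ (l + m)) d" for l m
      unfolding X_def
      by (subst funpow_rank_one_update) (simp_all add: funpow_add_apply \<phi>d)
    have Xd0: "(X ^^ l) d = (x ^^ l) d" for l using Xd[of l 0] by simp
    have "(X ^^ a) (w i) = (x ^^ a) (w i)"
      unfolding X_def
      by (rule funpow_rank_one_update) (simp add: \<phi>_def dual1 dual2 ij)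
    then have "(X ^^ Suc a) (w i) = x ((x ^^ a) (w i)) + scale t y"
      using dual1[OF ij(1), of a] dual2[OF ij(1), of a] ij by (simp add: X_def \<phi>_def)
    also have "x ((x ^^ a) (w i)) = (x ^^ Suc b) d"
      unfolding xd using zg[of "Suc b"] a(1) by (simp add: add.commute)
    finally have Xf: "(X ^^ Suc a) (w i) = (x ^^ Suc b) d + scale t ((x ^^ b) d)"
      by (simp add: y_def)
    have Xf': "(X ^^ (l + Suc a)) (w i) = (x ^^ (l + Suc b)) d + scale t ((x ^^ (l + b)) d)" for l
      unfolding funpow_add_apply[where x = X, symmetric] Xf by (simp only: powD[OF X] Xd)
    have zd: "(x ^^ l) d = 0" if "s + b \<le> l" for l
      unfolding xd using that a by (simp add: zf zg)
    have Xf0: "(X ^^ (p i + q i)) (w i) = 0"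
      unfolding a(3) Xf' by (simp add: zd endoD(3)[OF x])
    \<comment> \<open>Generation can be tested with \<open>d\<close> in place of \<open>w j\<close>:
      the direction \<open>y\<close> is a power of \<open>X\<close> on \<open>d\<close>, which gives
      back the old action and then \<open>w j\<close>.\<close>
    have old: "u \<in> W" if W: "subspace W" "X ` W \<subseteq> W" and fd: "w i \<in> W" "d \<in> W"
      and mem: "\<And>k. k < N \<Longrightarrow> k \<noteq> i \<Longrightarrow> k \<noteq> j \<Longrightarrow> w k \<in> W" for W u
    proof (rule generates_eqI[OF gen W(1)])
      have "y \<in> W" unfolding y_def Xd0[symmetric] by (rule funpow_mem[OF W(2) fd(2)])
      then show inv: "x ` W \<subseteq> W" by (rule rank_one_update_invariant[OF W[unfolded X_def]])
      have "d - (x ^^ r) (w i) \<in> W" by (intro subspace_diff funpow_mem[OF inv] W fd)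
      then have "w j \<in> W" by (simp add: d_def)
      then show "w k \<in> W" if "k < N" for k using mem[OF that] fd by (cases "k = i \<or> k = j") auto
    qed
    \<comment> \<open>A nilpotency exponent for \<open>X\<close>, which makes \<open>t + X\<close>
      invertible; the summand \<open>s + b\<close> takes care of \<open>d\<close>.\<close>
    define K where "K = (\<Sum>k<N. if k = j then s + b else p k + q k)"
    have nil: "(X ^^ K) u = 0" for u
      unfolding K_def
    proof (rule generates_nilpotent[OF X, where w = "w(j := d)"])
      show "generates X ((w(j := d)) ` {..<N})"
        unfolding generates_def
      proof (intro allI impI)
        fix W assume W: "subspace W" "X ` W \<subseteq> W" "(w(j := d)) ` {..<N} \<subseteq> W"
        have mem: "(w(j := d)) k \<in> W" if "k < N" for k using W(3) that by blast
        have "u \<in> W" for u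
        proof (rule old[OF W(1,2)])
          show "w k \<in> W" if "k < N" "k \<noteq> j" for k using mem[OF that(1)] that(2) by simp
        qed (use mem[OF ij(1)] mem[OF ij(2)] ij in simp_all)
        then show "W = UNIV" by blast
      qed
      show "(X ^^ (if k = j then s + b else p k + q k)) ((w(j := d)) k) = 0" if "k < N" for k
        using Xf0 Xd0 zd Xw[OF that] kill[OF that] by (cases "k = i"; cases "k = j") (auto simp: ij)
    qed
    let ?U = "\<lambda>u. scale t u + X u"
    note U = nilpotent_unit_solve[OF X nil t]
    have UX: "?U ((X ^^ l) u) = (X ^^ l) (?U u)" for l u
      by (simp add: powD[OF X] funpow_swap1)
    \<comment> \<open>\<open>t + X\<close> applied to the generator intended for row
      \<open>j\<close>; its relation is checked on \<open>G0\<close> and pulled back through the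
      injective map \<open>t + X\<close>.\<close>
    define G0 where "G0 = ?U d - (X ^^ (q i - q j)) (w i)"
    obtain F where F: "?U F = w i" using U(2) by blast
    obtain G where G: "?U G = G0" using U(2) by blast
    have XG0: "(X ^^ l) G0 = scale t ((x ^^ l) d) + (x ^^ Suc l) d - (X ^^ (l + (q i - q j))) (w i)" for l
    proof -
      have "(X ^^ l) (X d) = (x ^^ Suc l) d"
        using Xd0[of "Suc l"] by (simp add: funpow_swap1[where f = X])
      then show ?thesis by (simp only: G0_def powD[OF X] funpow_add_apply Xd0)
    qed
    let ?w' = "w(i := F, j := G)"
    have "row_gens N p q X v ?w'"
    proof (rule row_gensI[OF X])
      show "(X ^^ (p k + q k)) (?w' k) = 0" if "k < N" for k
      proof -
        consider "k = i" | "k = j" | "k \<noteq> i" "k \<noteq> j" by blast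
        then show "(X ^^ (p k + q k)) (?w' k) = 0"
        proof cases
          case 1
          have "?U ((X ^^ (p i + q i)) F) = 0" unfolding UX F by (rule Xf0)
          then have "(X ^^ (p i + q i)) F = 0" by (rule U(1))
          then show ?thesis using 1 ij by simp
        next
          case 2
          \<comment> \<open>This is the exponent at which \<open>Xf\<close> expresses the power of
            \<open>w i\<close> through \<open>d\<close>.\<close>
          have "b + (q i - q j) = Suc a" using a c by (simp add: b_def)
          then have "(X ^^ b) G0 = 0" unfolding XG0 using Xf by simp
          then have "?U ((X ^^ b) G) = 0" unfolding UX G .
          then have "(X ^^ b) G = 0" by (rule U(1))
          then show ?thesis using 2 by (simp add: b_def)
        next
          case 3
          then show ?thesis using Xw[OF that] kill[OF that] by simp
        qed
      qed
      show "u \<in> W" if W: "subspace W" "X ` W \<subseteq> W" and mem: "\<And>k. k < N \<Longrightarrow> ?w' k \<in> W" for W u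
      proof (rule old[OF W])
        have FG: "F \<in> W" "G \<in> W" using mem[OF ij(1)] mem[OF ij(2)] ij by simp_all
        have "?U F \<in> W" using W(2) FG by (intro subspace_add subspace_scale W(1)) auto
        then show f: "w i \<in> W" unfolding F .
        have "?U G \<in> W" using W(2) FG by (intro subspace_add subspace_scale W(1)) auto
        then have "?U d - (X ^^ (q i - q j)) (w i) + (X ^^ (q i - q j)) (w i) \<in> W"
          unfolding G G0_def by (intro subspace_add funpow_mem[OF W(2)] W(1) f)
        then have "scale t d + scale 1 ((X ^^ Suc 0) d) \<in> W" by simp
        then show "d \<in> W" by (rule nilpotent_unit_mem[OF X nil W t])
        show "w k \<in> W" if "k < N" "k \<noteq> i" "k \<noteq> j" for k using mem[OF that(1)] that by simp
      qed
      let ?V = "(x ^^ (q i - 1)) (w i) + (x ^^ q j) (w j)"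
      have V: "?V = (x ^^ q j) d" unfolding xd using r by (simp add: add.commute)
      have "?U ((X ^^ q i) F + (X ^^ q j) G - ?V) = ?U ((X ^^ q i) F) + ?U ((X ^^ q j) G) - ?U ?V"
        by (simp add: endoD[OF X] algebra_simps)
      also have "\<dots> = (X ^^ q i) (w i) + (X ^^ q j) G0 - ?U ((x ^^ q j) d)"
        unfolding UX F G V ..
      also have "\<dots> = 0"
        using c Xd[of 1 "q j"] unfolding XG0 by simp
      finally have "(X ^^ q i) F + (X ^^ q j) G - ?V = 0" by (rule U(1))
      then have "(X ^^ q i) F + (X ^^ q j) G = ?V" by simp
      moreover have "(\<Sum>k\<in>{..<N} - {i, j}. (X ^^ q k) (?w' k)) = (\<Sum>k\<in>{..<N} - {i, j}. (x ^^ q k) (w k))"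
        by (rule sum.cong) (auto simp: Xw)
      ultimately show "v = (\<Sum>k<N. (X ^^ q k) (?w' k))"
        unfolding v sum_split_two[OF ij] using ij by simp
    qed
    then show ?thesis unfolding X_def by blast
  qed
  then show "\<exists>v1 x1. \<forall>t. t \<noteq> 0 \<longrightarrow>
      (\<exists>w'. row_gens N p q (\<lambda>u. x u + scale t (x1 u)) (v + scale t v1) w')"
    by (intro exI[of _ 0] exI[of _ "\<lambda>u. scale (\<phi> u) y"]) simp
qed

subsection \<open>Independence is an open condition\<close>

text \<open>
  A member of \<open>poly_funs\<close> is also defined at pairs \<open>(v, x)\<close> with \<open>x\<close> not linear, where an iterate
  \<open>\<phi> (x (x w))\<close> need not be polynomial; only the values on the enhanced cone matter.
\<close>

definition regular_fun :: "('b \<times> ('b \<Rightarrow> 'b) \<Rightarrow> 'a) \<Rightarrow> bool" where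
  "regular_fun h \<longleftrightarrow> (\<exists>g\<in>poly_funs scale. \<forall>p\<in>enhanced_cone scale. g p = h p)"

lemma regular_fun_const: "regular_fun (\<lambda>_. c)"
  unfolding regular_fun_def by (intro bexI[of _ "\<lambda>_. c"] poly_funs.const) auto

lemma regular_fun_add:
  assumes "regular_fun f" "regular_fun g"
  shows "regular_fun (\<lambda>p. f p + g p)"
proof -
  obtain f' g' where "f' \<in> poly_funs scale" "g' \<in> poly_funs scale"
    "\<forall>p\<in>enhanced_cone scale. f' p = f p" "\<forall>p\<in>enhanced_cone scale. g' p = g p"
    using assms unfolding regular_fun_def by blast
  then show ?thesis
    unfolding regular_fun_def by (intro bexI[of _ "\<lambda>p. f' p + g' p"] poly_funs.add) auto
qed

lemma regular_fun_mult:
  assumes "regular_fun f" "regular_fun g"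
  shows "regular_fun (\<lambda>p. f p * g p)"
proof -
  obtain f' g' where "f' \<in> poly_funs scale" "g' \<in> poly_funs scale"
    "\<forall>p\<in>enhanced_cone scale. f' p = f p" "\<forall>p\<in>enhanced_cone scale. g' p = g p"
    using assms unfolding regular_fun_def by blast
  then show ?thesis
    unfolding regular_fun_def by (intro bexI[of _ "\<lambda>p. f' p * g' p"] poly_funs.mult) auto
qed

lemma regular_fun_diff:
  assumes "regular_fun f" "regular_fun g"
  shows "regular_fun (\<lambda>p. f p - g p)"
  using regular_fun_add[OF assms(1) regular_fun_mult[OF regular_fun_const[of "- 1"] assms(2)]] by simp

lemma regular_fun_sum:
  "finite T \<Longrightarrow> (\<And>i. i \<in> T \<Longrightarrow> regular_fun (f i)) \<Longrightarrow> regular_fun (\<lambda>p. \<Sum>i\<in>T. f i p)"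
  by (induction T rule: finite_induct) (simp_all add: regular_fun_const regular_fun_add)

definition regular_vec :: "('b \<times> ('b \<Rightarrow> 'b) \<Rightarrow> 'b) \<Rightarrow> bool" where
  "regular_vec u \<longleftrightarrow> (\<forall>\<phi>. functional \<phi> \<longrightarrow> regular_fun (\<lambda>p. \<phi> (u p)))"

lemma regular_vec_const: "regular_vec (\<lambda>_. w)"
  by (simp add: regular_vec_def regular_fun_const)

lemma regular_vec_fst: "regular_vec fst"
  unfolding regular_vec_def
proof (intro allI impI)
  fix \<phi> assume "functional \<phi>"
  then have "(\<lambda>(v, x). \<phi> v) \<in> poly_funs scale" by (rule poly_funs.vector_coord)
  then show "regular_fun (\<lambda>p. \<phi> (fst p))"
    unfolding regular_fun_def by (intro bexI) auto
qed

lemma functional_coordinate: "functional (\<lambda>u. representation Basis u b)"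
  by (rule functionalI)
    (simp_all add: representation_add representation_scale independent_Basis span_Basis)

text \<open>Expanding \<open>u p\<close> in \<open>Basis\<close> gives a sum of its coordinates
  times matrix coefficients. The expansion uses linearity of \<open>snd p\<close>, which holds on
  the cone.\<close>

lemma regular_vec_apply:
  assumes "regular_vec u"
  shows "regular_vec (\<lambda>p. snd p (u p))"
  unfolding regular_vec_def
proof (intro allI impI)
  fix \<phi> assume \<phi>: "functional \<phi>"
  let ?h = "\<lambda>p. \<Sum>b\<in>Basis. representation Basis (u p) b * \<phi> (snd p b)"
  have "regular_fun (\<lambda>p. \<phi> (snd p b))" for b
  proof -
    have "(\<lambda>(v, x). \<phi> (x b)) \<in> poly_funs scale" using \<phi> by (rule poly_funs.matrix_coeff)
    then show ?thesis unfolding regular_fun_def by (intro bexI) auto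
  qed
  then have "regular_fun ?h"
    using assms functional_coordinate finite_Basis unfolding regular_vec_def
    by (intro regular_fun_sum regular_fun_mult) auto
  moreover have "?h p = \<phi> (snd p (u p))" if "p \<in> enhanced_cone scale" for p
  proof -
    have x: "endo (snd p)" using that by (auto simp: enhanced_cone_def nilpotent_endos_def)
    have "u p = (\<Sum>b\<in>Basis. scale (representation Basis (u p) b) b)"
      using sum_representation_eq[OF independent_Basis _ finite_Basis order_refl, of "u p"]
      by (simp add: span_Basis)
    then have "\<phi> (snd p (u p)) = \<phi> (snd p (\<Sum>b\<in>Basis. scale (representation Basis (u p) b) b))"
      by (rule arg_cong)
    then show ?thesis by (simp only: endoD[OF x] functionalD[OF \<phi>])
  qed
  ultimately show "regular_fun (\<lambda>p. \<phi> (snd p (u p)))"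
    unfolding regular_fun_def by metis
qed

lemma regular_vec_funpow:
  assumes "regular_vec u"
  shows "regular_vec (\<lambda>p. (snd p ^^ k) (u p))"
  by (induction k) (simp_all add: assms regular_vec_apply)

text \<open>Indexed independence, where a repeated vector counts as a relation. This matters when
  the family is evaluated at varying points, where distinct indices may give equal vectors.\<close>

definition indep_family :: "'i set \<Rightarrow> ('i \<Rightarrow> 'b) \<Rightarrow> bool" where
  "indep_family J z \<longleftrightarrow> (\<forall>c. (\<Sum>b\<in>J. scale (c b) (z b)) = 0 \<longrightarrow> (\<forall>b\<in>J. c b = 0))"

lemma indep_familyD:
  "indep_family J z \<Longrightarrow> (\<Sum>b\<in>J. scale (c b) (z b)) = 0 \<Longrightarrow> b \<in> J \<Longrightarrow> c b = 0"
  unfolding indep_family_def by blast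

lemma indep_family_independent:
  assumes J: "finite J" and z: "indep_family J z"
  shows "inj_on z J" "independent (z ` J)"
proof -
  show inj: "inj_on z J"
  proof (rule inj_onI, rule ccontr)
    fix a b assume ab: "a \<in> J" "b \<in> J" "z a = z b" "a \<noteq> b"
    define c where "c = (\<lambda>i. if i = a then 1 else if i = b then - 1 else (0 :: 'a))"
    have "(\<Sum>i\<in>J. scale (c i) (z i)) = (\<Sum>i\<in>{a, b}. scale (c i) (z i))"
      using ab J by (intro sum.mono_neutral_right) (auto simp: c_def)
    also have "\<dots> = 0" using ab by (simp add: c_def)
    finally have "c a = 0" by (rule indep_familyD[OF z _ ab(1)])
    then show False by (simp add: c_def)
  qed
  show "independent (z ` J)"
  proof (rule independent_if_scalars_zero)
    fix f y assume "(\<Sum>y\<in>z ` J. scale (f y) y) = 0" and y: "y \<in> z ` J"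
    then have "(\<Sum>b\<in>J. scale (f (z b)) (z b)) = 0" by (simp add: sum.reindex[OF inj])
    then have "\<forall>b\<in>J. f (z b) = 0" using z unfolding indep_family_def by meson
    then show "f y = 0" using y by blast
  qed (use J in simp)
qed

lemma indep_family_card:
  assumes "finite J" "indep_family J z" "finite T" "z ` J \<subseteq> span T"
  shows "card J \<le> card T"
  using indep_family_independent[OF assms(1,2)] independent_span_bound[OF assms(3) _ assms(4)]
  by (metis card_image)

lemma indep_family_subset:
  assumes "finite J" "indep_family J z" "I \<subseteq> J"
  shows "indep_family I z"
  unfolding indep_family_def
proof (intro allI impI)
  fix c assume 0: "(\<Sum>b\<in>I. scale (c b) (z b)) = 0"
  have "(\<Sum>b\<in>J. scale (if b \<in> I then c b else 0) (z b)) = (\<Sum>b\<in>I. scale (c b) (z b))"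
    using assms(1,3) by (intro sum.mono_neutral_cong_right) auto
  then have "(if b \<in> I then c b else 0) = 0" if "b \<in> J" for b
    using indep_familyD[OF assms(2), where c = "\<lambda>b. if b \<in> I then c b else 0"] 0 that by simp
  then show "\<forall>b\<in>I. c b = 0" using assms(3) by (metis subsetD)
qed

text \<open>
  Eliminating one vector at a time with a functional replaces the usual minors of a matrix.
\<close>

lemma indep_family_open:
  assumes "finite J" "\<And>b. b \<in> J \<Longrightarrow> regular_vec (u b)" "indep_family J (\<lambda>b. u b p0)"
  shows "\<exists>f. regular_fun f \<and> f p0 \<noteq> 0 \<and> (\<forall>q. f q \<noteq> 0 \<longrightarrow> indep_family J (\<lambda>b. u b q))"
  using assms
proof (induction J arbitrary: u rule: finite_induct)
  case empty
  show ?case by (intro exI[of _ "\<lambda>_. 1"]) (simp add: regular_fun_const indep_family_def)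
next
  case (insert m J)
  note ind = indep_family_independent[OF _ insert.prems(2)]
  obtain \<phi> where \<phi>: "functional \<phi>"
    and \<phi>v: "\<forall>y\<in>(\<lambda>b. u b p0) ` insert m J. \<phi> y = (if y = u m p0 then 1 else 0)"
    using exists_functional[OF ind(2), of "\<lambda>y. if y = u m p0 then 1 else 0"] insert.hyps(1) by auto
  have \<phi>m: "\<phi> (u m p0) = 1" using \<phi>v by simp
  have \<phi>b: "\<phi> (u b p0) = 0" if "b \<in> J" for b
  proof -
    have "b \<noteq> m" using that insert.hyps(2) by blast
    then have "u b p0 \<noteq> u m p0" using inj_onD[OF ind(1), of b m] insert.hyps(1) that by auto
    then show ?thesis using \<phi>v that by simp
  qed
  \<comment> \<open>Elimination without division, so that \<open>u'\<close> stays regular: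
    \<open>u' b q\<close> lies in the kernel of \<open>\<phi>\<close>, and at \<open>p0\<close> it
    equals \<open>u b p0\<close>.\<close>
  define u' where "u' = (\<lambda>b q. scale (\<phi> (u m q)) (u b q) - scale (\<phi> (u b q)) (u m q))"
  have reg\<phi>: "regular_fun (\<lambda>q. \<phi> (u b q))" if "b \<in> insert m J" for b
    using insert.prems(1)[OF that] \<phi> by (simp add: regular_vec_def)
  have "\<exists>f. regular_fun f \<and> f p0 \<noteq> 0 \<and> (\<forall>q. f q \<noteq> 0 \<longrightarrow> indep_family J (\<lambda>b. u' b q))"
  proof (rule insert.IH)
    show "regular_vec (u' b)" if b: "b \<in> J" for b
      unfolding regular_vec_def
    proof (intro allI impI)
      fix \<psi> assume \<psi>: "functional \<psi>"
      have "regular_fun (\<lambda>q. \<psi> (u c q))" if "c \<in> insert m J" for c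
        using insert.prems(1)[OF that] \<psi> by (simp add: regular_vec_def)
      then show "regular_fun (\<lambda>q. \<psi> (u' b q))"
        unfolding u'_def functionalD[OF \<psi>] using b
        by (intro regular_fun_diff regular_fun_mult reg\<phi>) auto
    qed
    have "indep_family J (\<lambda>b. u b p0)"
      by (rule indep_family_subset[OF _ insert.prems(2)]) (use insert.hyps(1) in auto)
    moreover have "u' b p0 = u b p0" if "b \<in> J" for b
      using \<phi>m \<phi>b[OF that] by (simp add: u'_def)
    ultimately show "indep_family J (\<lambda>b. u' b p0)" unfolding indep_family_def by simp
  qed
  then obtain f where f: "regular_fun f" "f p0 \<noteq> 0"
    "\<And>q. f q \<noteq> 0 \<Longrightarrow> indep_family J (\<lambda>b. u' b q)" by blast
  have "indep_family (insert m J) (\<lambda>b. u b q)" if q: "f q * \<phi> (u m q) \<noteq> 0" for q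
    unfolding indep_family_def
  proof (intro allI impI)
    fix c assume 0: "(\<Sum>b\<in>insert m J. scale (c b) (u b q)) = 0"
    have s: "(\<Sum>b\<in>J. scale (c b) (u b q)) = - scale (c m) (u m q)"
      using 0 insert.hyps by (simp add: add_eq_0_iff)
    have "(\<Sum>b\<in>J. c b * \<phi> (u b q)) = \<phi> (\<Sum>b\<in>J. scale (c b) (u b q))"
      by (simp add: functionalD[OF \<phi>])
    also have "\<dots> = - (c m * \<phi> (u m q))" unfolding s by (simp add: functionalD[OF \<phi>])
    finally have t: "(\<Sum>b\<in>J. c b * \<phi> (u b q)) = - (c m * \<phi> (u m q))" .
    \<comment> \<open>A relation among the \<open>u b q\<close>, combined with its image under
      \<open>\<phi>\<close>, becomes a relation with the same coefficients among the
      \<open>u' b q\<close>.\<close>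
    have "(\<Sum>b\<in>J. scale (c b) (u' b q)) =
        scale (\<phi> (u m q)) (\<Sum>b\<in>J. scale (c b) (u b q)) - scale (\<Sum>b\<in>J. c b * \<phi> (u b q)) (u m q)"
      by (simp add: u'_def scale_right_diff_distrib sum_subtractf scale_sum_right scale_sum_left mult.commute)
    also have "\<dots> = 0" unfolding s t by (simp add: mult.commute)
    finally have z: "\<forall>b\<in>J. c b = 0" using f(3)[of q] q unfolding indep_family_def by simp
    then have "scale (c m) (u m q) = 0" using s by simp
    moreover have "u m q \<noteq> 0" using q functionalD(3)[OF \<phi>] by auto
    ultimately show "\<forall>b\<in>insert m J. c b = 0" using z by simp
  qed
  then show ?case
    using f \<phi>m by (intro exI[of _ "\<lambda>q. f q * \<phi> (u m q)"]) (simp add: regular_fun_mult reg\<phi>)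
qed

text \<open>A regular function detecting independence is nonzero at \<open>p\<close>, hence
  somewhere on \<open>S\<close>; on the cone it agrees with a member of
  \<open>poly_funs\<close>.\<close>

lemma indep_family_closure:
  assumes "finite J" "\<And>b. b \<in> J \<Longrightarrow> regular_vec (u b)" "indep_family J (\<lambda>b. u b p)"
    and p: "p \<in> zariski scale closure_of S" and S: "S \<subseteq> enhanced_cone scale"
  shows "\<exists>s\<in>S. indep_family J (\<lambda>b. u b s)"
proof -
  obtain f where f: "regular_fun f" "f p \<noteq> 0" "\<And>q. f q \<noteq> 0 \<Longrightarrow> indep_family J (\<lambda>b. u b q)"
    using indep_family_open[OF assms(1-3)] by blast
  obtain g where g: "g \<in> poly_funs scale" "\<And>q. q \<in> enhanced_cone scale \<Longrightarrow> g q = f q"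
    using f(1) unfolding regular_fun_def by blast
  have "p \<in> enhanced_cone scale" using p by (simp add: in_closure_of topspace_zariski)
  then have "g p \<noteq> 0" using g(2) f(2) by simp
  then obtain s where "s \<in> S" "g s \<noteq> 0" using zariski_closureD[OF p g(1)] by blast
  then show ?thesis using g(2) f(3) S by (metis subsetD)
qed

subsection \<open>Submodules generated by \<open>v\<close> and \<open>k\<close> further vectors\<close>

text \<open>
  The family below consists of \<open>r\<close> vectors \<open>x^j v\<close> and of vectors \<open>x^j w\<^sub>i\<close> with \<open>i < k\<close>; the
  former carry the first index \<open>k\<close>.
\<close>

definition cyclic_family :: "nat \<Rightarrow> (nat \<Rightarrow> 'b) \<Rightarrow> nat \<times> nat \<Rightarrow> 'b \<times> ('b \<Rightarrow> 'b) \<Rightarrow> 'b" where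
  "cyclic_family k w = (\<lambda>(i, j) (v, x). (x ^^ j) (if i < k then w i else v))"

definition cyclic_index :: "nat \<Rightarrow> (nat \<Rightarrow> nat) \<Rightarrow> nat \<Rightarrow> (nat \<times> nat) set" where
  "cyclic_index k l r = row_index k l \<union> {k} \<times> {..<r}"

lemma finite_cyclic_index: "finite (cyclic_index k l r)"
  by (simp add: cyclic_index_def)

lemma card_cyclic_index: "card (cyclic_index k l r) = (\<Sum>i<k. l i) + r"
proof -
  have "row_index k l \<inter> {k} \<times> {..<r} = {}" by (auto simp: row_index_def)
  then show ?thesis
    by (simp add: cyclic_index_def card_Un_disjoint card_row_index card_cartesian_product)
qed

text \<open>The vectors \<open>w i\<close> are constants; only \<open>v\<close> and \<open>x\<close>
  vary with the point.\<close>

lemma regular_cyclic_family: "regular_vec (cyclic_family k w b)"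
proof -
  obtain i j where b: "b = (i, j)" by fastforce
  have "regular_vec (\<lambda>p. (snd p ^^ j) (if i < k then w i else fst p))"
    by (rule regular_vec_funpow, cases "i < k")
      (use regular_vec_const regular_vec_fst in simp_all)
  moreover have "cyclic_family k w b = (\<lambda>p. (snd p ^^ j) (if i < k then w i else fst p))"
    by (auto simp: b cyclic_family_def)
  ultimately show ?thesis by simp
qed

text \<open>In row \<open>k\<close> the vectors \<open>x^j v\<close> with \<open>j < p k\<close>
  have the distinct leading terms \<open>x^(q k + j) (w k)\<close>, which the rows
  \<open>i < k\<close> do not meet. So the coefficients on \<open>v\<close> are eliminated
  first.\<close>

lemma cyclic_family_independent:
  assumes w: "row_gens N p q x v w" and n: "(\<Sum>i<N. p i + q i) = dimension"
    and k: "k < N" and r: "r \<le> p k"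
  shows "indep_family (cyclic_index k (\<lambda>i. p i + q i) r) (\<lambda>b. cyclic_family k w b (v, x))"
  unfolding indep_family_def
proof (intro allI impI ballI)
  let ?J = "cyclic_index k (\<lambda>i. p i + q i) r"
  let ?u = "\<lambda>b. cyclic_family k w b (v, x)"
  fix c b assume 0: "(\<Sum>b\<in>?J. scale (c b) (?u b)) = 0" and b: "b \<in> ?J"
  have x: "endo x" and v: "v = (\<Sum>i<N. (x ^^ q i) (w i))" using w by (simp_all add: row_gens_def)
  have fin: "finite ?J" by (rule finite_cyclic_index)
  have F: "(\<Sum>b\<in>?J. c b * \<phi> (?u b)) = 0" if "functional \<phi>" for \<phi>
  proof -
    have "(\<Sum>b\<in>?J. c b * \<phi> (?u b)) = \<phi> (\<Sum>b\<in>?J. scale (c b) (?u b))"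
      by (simp add: functionalD[OF that])
    then show ?thesis using 0 functionalD(3)[OF that] by simp
  qed
  have top: "c (k, j) = 0" if "(k, j) \<in> ?J" for j
  proof -
    have j: "q k + j < p k + q k" using that r by (auto simp: cyclic_index_def row_index_def)
    obtain \<phi> where \<phi>: "functional \<phi>"
      and dual: "\<And>i l. i < N \<Longrightarrow> \<phi> ((x ^^ l) (w i)) = (if i = k \<and> l = q k + j then 1 else 0)"
      using row_gens_dual[OF w n j k] by blast
    have "\<phi> ((x ^^ l) v) = (if l = j then 1 else 0)" for l
    proof -
      have "\<phi> ((x ^^ l) v) = (\<Sum>i<N. if i = k \<and> l + q i = q k + j then 1 else 0)"
        by (simp add: v powD[OF x] functionalD[OF \<phi>] funpow_add_apply dual)
      also have "\<dots> = (\<Sum>i<N. if k = i then if l = j then 1 else 0 else 0)"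
        by (rule sum.cong) auto
      finally show ?thesis using k by simp
    qed
    then have "c b * \<phi> (?u b) = (if b = (k, j) then c b else 0)" if "b \<in> ?J" for b
      using that k by (auto simp: cyclic_index_def cyclic_family_def row_index_def dual split: if_splits)
    then have "(\<Sum>b\<in>?J. c b * \<phi> (?u b)) = (\<Sum>b\<in>?J. if b = (k, j) then c b else 0)"
      by (intro sum.cong) auto
    then show ?thesis using F[OF \<phi>] that fin by simp
  qed
  show "c b = 0"
  proof (cases "fst b < k")
    case False
    then have "b = (k, snd b)" using b by (auto simp: cyclic_index_def row_index_def)
    then show ?thesis using top[of "snd b"] b by metis
  next
    case True
    obtain i j where ij: "b = (i, j)" by fastforce
    then have j: "j < p i + q i" "i < k" using b True by (auto simp: cyclic_index_def row_index_def)
    have i: "i < N" using j k by simp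
    obtain \<phi> where \<phi>: "functional \<phi>"
      and dual: "\<And>i' l. i' < N \<Longrightarrow> \<phi> ((x ^^ l) (w i')) = (if i' = i \<and> l = j then 1 else 0)"
      using row_gens_dual[OF w n j(1) i] by blast
    \<comment> \<open>\<open>\<phi>\<close> need not vanish on the powers of \<open>v\<close>, but
      their coefficients are 0 by \<open>top\<close>.\<close>
    have "c b' * \<phi> (?u b') = (if b' = b then c b' else 0)" if b': "b' \<in> ?J" for b'
    proof (cases "fst b' < k")
      case True
      then show ?thesis using k by (auto simp: cyclic_family_def dual ij split: prod.split)
    next
      case False
      then have "b' = (k, snd b')" using b' by (auto simp: cyclic_index_def row_index_def)
      then have "c b' = 0" using top[of "snd b'"] b' by metis
      then show ?thesis by auto
    qed
    then have "(\<Sum>b'\<in>?J. c b' * \<phi> (?u b')) = (\<Sum>b'\<in>?J. if b' = b then c b' else 0)"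
      by (intro sum.cong) auto
    then show ?thesis using F[OF \<phi>] b fin by simp
  qed
qed

text \<open>
  With \<open>s = p k + q k\<close>, both \<open>x^s V\<close> and \<open>x^(p k) v\<close> lie in the submodule spanned by the
  \<open>x^(s + j) z\<^sub>i\<close> with \<open>i < k\<close>, since \<open>q\<close> is decreasing.
\<close>

lemma cyclic_family_card:
  assumes z: "row_gens N p q x v z" and k: "k < N"
    and anti: "antimono p" "antimono q"
    and ind: "indep_family (cyclic_index k l r) (\<lambda>b. cyclic_family k w b (v, x))"
  shows "(\<Sum>i<k. l i) + r \<le> (\<Sum>i<k. p i + q i) + (if r = 0 then 0 else p k)"
proof -
  have x: "endo x" and kill: "\<And>i. i < N \<Longrightarrow> (x ^^ (p i + q i)) (z i) = 0"
    and gen: "generates x (z ` {..<N})" and v: "v = (\<Sum>i<N. (x ^^ q i) (z i))"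
    using z by (auto simp: row_gens_def)
  define s where "s = p k + q k"
  \<comment> \<open>\<open>Z\<close> catches the high powers, \<open>A\<close> the powers
    \<open>x^j (w i)\<close> below \<open>s\<close>, and \<open>B\<close> the powers of
    \<open>v\<close> below \<open>p k\<close>, if any occur. The sizes add up to the bound, as
    \<open>(p i + q i - s) + s = p i + q i\<close> for \<open>i < k\<close>.\<close>
  define Z where "Z = (\<lambda>(i, j). (x ^^ (s + j)) (z i)) ` row_index k (\<lambda>i. p i + q i - s)"
  define A where "A = (\<lambda>(i, j). (x ^^ j) (w i)) ` row_index k (\<lambda>_. s)"
  define B where "B = (if r = 0 then {} else (\<lambda>j. (x ^^ j) v) ` {..<p k})"
  have le: "s \<le> p i + q i" if "i < k" for i
    using anti that unfolding s_def by (intro add_mono) (auto simp: antimono_def)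
  have ge: "p i + q i \<le> s" if "k \<le> i" for i
    using anti that unfolding s_def by (intro add_mono) (auto simp: antimono_def)
  have memZ: "(x ^^ m) (z i) \<in> span Z" if "s \<le> m" "i < N" for m i
  proof (cases "m < p i + q i")
    case True
    then have "i < k" using ge[of i] that by (cases "i < k") auto
    then have "(i, m - s) \<in> row_index k (\<lambda>i. p i + q i - s)"
      using True that by (simp add: row_index_def)
    then have "(\<lambda>(i, j). (x ^^ (s + j)) (z i)) (i, m - s) \<in> Z" unfolding Z_def by blast
    then show ?thesis using that by (simp add: span_base)
  next
    case False
    then have "(x ^^ m) (z i) = 0" using funpow_zero_mono[OF x kill[OF that(2)]] by simp
    then show ?thesis by (simp add: span_zero)
  qed
  have invZ: "x ` span Z \<subseteq> span Z"
  proof -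
    have "x ` span Z = span (x ` Z)"
      using x by (simp add: linear_iff_module_hom module_hom.span_image)
    also have "\<dots> \<subseteq> span Z"
    proof (rule span_minimal)
      show "x ` Z \<subseteq> span Z"
        unfolding Z_def
      proof clarify
        fix i j assume "(i, j) \<in> row_index k (\<lambda>i. p i + q i - s)"
        then have "(x ^^ Suc (s + j)) (z i) \<in> span Z"
          by (intro memZ) (use k in \<open>auto simp: row_index_def\<close>)
        then show "x ((x ^^ (s + j)) (z i)) \<in> span ((\<lambda>(i, j). (x ^^ (s + j)) (z i)) ` row_index k (\<lambda>i. p i + q i - s))"
          by (simp add: Z_def)
      qed
    qed simp
    finally show ?thesis .
  qed
  have powZ: "(x ^^ m) u \<in> span Z" if "s \<le> m" for m u
  proof -
    have "u \<in> {u. (x ^^ m) u \<in> span Z}"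
    proof (rule generates_eqI[OF gen])
      show "subspace {u. (x ^^ m) u \<in> span Z}"
        by (rule subspaceI) (auto simp: powD[OF x] intro: span_zero span_add span_scale)
      show "x ` {u. (x ^^ m) u \<in> span Z} \<subseteq> {u. (x ^^ m) u \<in> span Z}"
        using invZ by (auto simp: funpow_swap1[where f = x, symmetric])
    qed (use memZ that in auto)
    then show ?thesis by simp
  qed
  \<comment> \<open>For \<open>i < k\<close> the exponent \<open>m + q i\<close> is at least
    \<open>s\<close>; for the other rows it is at least \<open>p i + q i\<close>, so the term is
    0.\<close>
  have powv: "(x ^^ m) v \<in> span Z" if "p k \<le> m" for m
    unfolding v powD[OF x]
  proof (rule span_sum)
    fix i assume i: "i \<in> {..<N}"
    show "(x ^^ m) ((x ^^ q i) (z i)) \<in> span Z"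
    proof (cases "i < k")
      case True
      then have "q k \<le> q i" using anti(2) by (auto simp: antimono_def)
      then show ?thesis unfolding funpow_add_apply using that i by (intro memZ) (auto simp: s_def)
    next
      case False
      then have "p i \<le> p k" using anti(1) by (auto simp: antimono_def)
      then have "(x ^^ (m + q i)) (z i) = 0"
        using funpow_zero_mono[OF x kill] i that by auto
      then show ?thesis unfolding funpow_add_apply by (simp add: span_zero)
    qed
  qed
  have "finite (Z \<union> A \<union> B)" by (simp add: Z_def A_def B_def)
  moreover have "(\<lambda>b. cyclic_family k w b (v, x)) ` cyclic_index k l r \<subseteq> span (Z \<union> A \<union> B)"
  proof clarify
    fix i j assume b: "(i, j) \<in> cyclic_index k l r"
    have Z: "span Z \<subseteq> span (Z \<union> A \<union> B)" by (rule span_mono) blast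
    show "cyclic_family k w (i, j) (v, x) \<in> span (Z \<union> A \<union> B)"
    proof (cases "i < k")
      case True
      show ?thesis
      proof (cases "s \<le> j")
        case False
        then have "(i, j) \<in> row_index k (\<lambda>_. s)" using True by (simp add: row_index_def)
        then have "(\<lambda>(i, j). (x ^^ j) (w i)) (i, j) \<in> A" unfolding A_def by (rule imageI)
        then show ?thesis using True by (auto simp: cyclic_family_def intro: span_base)
      qed (use powZ Z True in \<open>auto simp: cyclic_family_def\<close>)
    next
      case False
      then have r: "r \<noteq> 0" using b by (auto simp: cyclic_index_def row_index_def)
      show ?thesis
      proof (cases "p k \<le> j")
        case False
        then have "(x ^^ j) v \<in> B" using r by (auto simp: B_def)
        then show ?thesis using \<open>\<not> i < k\<close> by (auto simp: cyclic_family_def intro: span_base)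
      qed (use powv Z \<open>\<not> i < k\<close> in \<open>auto simp: cyclic_family_def\<close>)
    qed
  qed
  ultimately have "card (cyclic_index k l r) \<le> card (Z \<union> A \<union> B)"
    by (rule indep_family_card[OF finite_cyclic_index ind])
  also have "\<dots> \<le> card Z + card A + card B"
    by (meson add_right_mono card_Un_le order_trans)
  also have "card Z \<le> (\<Sum>i<k. p i + q i - s)"
    unfolding Z_def card_row_index[symmetric] by (rule card_image_le) simp
  also have "card A \<le> (\<Sum>i<k. s)"
    unfolding A_def card_row_index[symmetric] by (rule card_image_le) simp
  also have "card B \<le> (if r = 0 then 0 else p k)"
    using card_image_le[of "{..<p k}" "\<lambda>j. (x ^^ j) v"] by (simp add: B_def)
  also have "(\<Sum>i<k. p i + q i - s) + (\<Sum>i<k. s) = (\<Sum>i<k. p i + q i)"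
    unfolding sum.distrib[symmetric] by (rule sum.cong) (use le in auto)
  finally show ?thesis unfolding card_cyclic_index by simp
qed

end

subsection \<open>Dominance order on interleaved bipartitions\<close>

text \<open>
  A bipartition \<open>(\<mu>; \<nu>)\<close> is encoded as the interleaved sequence
  \<open>\<mu> 0, \<nu> 0, \<mu> 1, \<nu> 1, \<dots>\<close>, which turns \<open>bipartition_le\<close> into comparison of all partial sums.
\<close>

definition interleave :: "(nat \<Rightarrow> nat) \<Rightarrow> (nat \<Rightarrow> nat) \<Rightarrow> nat \<Rightarrow> nat" where
  "interleave p q m = (if even m then p (m div 2) else q (m div 2))"

definition two_step_antimono :: "(nat \<Rightarrow> nat) \<Rightarrow> bool" where
  "two_step_antimono \<kappa> \<longleftrightarrow> (\<forall>i. \<kappa> (i + 2) \<le> \<kappa> i)"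

definition dominated :: "(nat \<Rightarrow> nat) \<Rightarrow> (nat \<Rightarrow> nat) \<Rightarrow> bool" where
  "dominated r \<kappa> \<longleftrightarrow> (\<forall>m. sum r {..<m} \<le> sum \<kappa> {..<m})"

definition box_move :: "(nat \<Rightarrow> nat) \<Rightarrow> nat \<Rightarrow> nat \<Rightarrow> nat \<Rightarrow> nat" where
  "box_move \<kappa> a b = \<kappa>(a := \<kappa> a - 1, b := \<kappa> b + 1)"

text \<open>A batch of box moves from each \<open>c + 2 * j\<close> to its right neighbour. Within
  runs of equal entries they are made together, as a single one could violate
  \<open>two_step_antimono\<close>.\<close>

definition run_move :: "(nat \<Rightarrow> nat) \<Rightarrow> nat \<Rightarrow> nat \<Rightarrow> nat \<Rightarrow> nat" where
  "run_move \<kappa> c l i =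
    (if c \<le> i \<and> i \<le> c + 2 * l + 1 then if even (i - c) then \<kappa> i - 1 else \<kappa> i + 1 else \<kappa> i)"

lemma two_step_antimonoD:
  assumes "two_step_antimono \<kappa>"
  shows "\<kappa> (i + 2 * k) \<le> \<kappa> i"
proof (induction k)
  case (Suc k)
  have "\<kappa> (i + 2 * k + 2) \<le> \<kappa> (i + 2 * k)" using assms by (simp add: two_step_antimono_def)
  with Suc show ?case by (simp add: algebra_simps)
qed simp

lemma sum_box_move:
  assumes "a < b" "\<kappa> a > 0"
  shows "sum (box_move \<kappa> a b) {..<m} + (if a < m \<and> m \<le> b then 1 else 0) = sum \<kappa> {..<m}"
  using assms by (induction m) (auto simp: box_move_def less_Suc_eq)

lemma sum_run_move:
  assumes "\<And>j. j \<le> l \<Longrightarrow> \<kappa> (c + 2 * j) > 0"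
  shows "sum (run_move \<kappa> c l) {..<m} + (if c < m \<and> m \<le> c + 2 * l + 1 \<and> odd (m - c) then 1 else 0) =
    sum \<kappa> {..<m}"
proof (induction m)
  case (Suc m)
  consider "m < c" | "m > c + 2 * l + 1" | j where "m = c + 2 * j" "j \<le> l" | j where "m = c + 2 * j + 1" "j \<le> l"
  proof -
    assume *: "m < c \<Longrightarrow> thesis" "m > c + 2 * l + 1 \<Longrightarrow> thesis"
      "\<And>j. m = c + 2 * j \<Longrightarrow> j \<le> l \<Longrightarrow> thesis" "\<And>j. m = c + 2 * j + 1 \<Longrightarrow> j \<le> l \<Longrightarrow> thesis"
    show thesis
    proof (cases "m < c \<or> m > c + 2 * l + 1")
      case False
      then have m: "m = c + 2 * ((m - c) div 2) \<or> m = c + 2 * ((m - c) div 2) + 1" "(m - c) div 2 \<le> l"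
        by presburger+
      then show thesis using *(3,4) by blast
    qed (use * in blast)
  qed
  then show ?case
  proof cases
    case 3
    then show ?thesis using Suc assms[of j] by (simp add: run_move_def)
  qed (use Suc in \<open>simp_all add: run_move_def\<close>)
qed simp

text \<open>\<open>a\<close> ends the run of \<open>\<kappa>\<close> starting at the first excess
  over \<open>r\<close>, and \<open>b\<close> starts a run ending in a later deficit. Runs follow
  one parity, so removing a box at \<open>a\<close> and adding one at \<open>b\<close> respects
  \<open>two_step_antimono\<close>. If \<open>a + 1 < b\<close>, a box moves from \<open>a\<close>
  to \<open>b\<close>; otherwise the runs have opposite parity and overlap, and boxes move to the
  right neighbour along the overlap.\<close>

lemma dominance_step:
  assumes \<kappa>: "two_step_antimono \<kappa>" and r: "two_step_antimono r"
    and dom: "dominated r \<kappa>" and tail: "\<forall>m\<ge>M. sum \<kappa> {..<m} = sum r {..<m}"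
    and ne: "\<kappa> \<noteq> r"
  shows "\<exists>\<kappa>'. two_step_antimono \<kappa>' \<and> dominated r \<kappa>' \<and> dominated \<kappa>' \<kappa> \<and>
    (\<exists>m. sum \<kappa>' {..<m} < sum \<kappa> {..<m}) \<and>
    ((\<exists>a b. \<kappa>' = box_move \<kappa> a b \<and> a + 2 \<le> b \<and> b < M \<and> 0 < \<kappa> a) \<or>
     (\<exists>c l. \<kappa>' = run_move \<kappa> c l \<and> c + 2 * l + 1 < M \<and> 0 < \<kappa> c \<and>
       (\<forall>j\<le>l. \<kappa> (c + 2 * j) = \<kappa> c \<and> \<kappa> (c + 2 * j + 1) = \<kappa> (c + 1)) \<and>
       \<kappa> (c + 2 * l + 2) < \<kappa> c \<and> (0 < c \<longrightarrow> \<kappa> (c + 1) < \<kappa> (c - 1))))"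
proof -
  note tail = tail[rule_format]
  note mono = two_step_antimonoD[OF \<kappa>] and rmono = two_step_antimonoD[OF r]
  have \<kappa>2: "\<kappa> (i + 2) \<le> \<kappa> i" for i using mono[of i 1] by simp
  let ?S = "\<lambda>m. sum \<kappa> {..<m}" and ?R = "\<lambda>m. sum r {..<m}"
  have le: "?R m \<le> ?S m" for m using dom by (simp add: dominated_def)
  define p where "p = (LEAST i. \<kappa> i \<noteq> r i)"
  have pne: "\<kappa> p \<noteq> r p"
  proof -
    obtain i where "\<kappa> i \<noteq> r i" using ne by blast
    then show ?thesis unfolding p_def by (rule LeastI)
  qed
  have below: "\<kappa> i = r i" if "i < p" for i using not_less_Least[of i] that by (auto simp: p_def)
  have "?S p = ?R p" by (rule sum.cong) (auto simp: below)
  with le[of "Suc p"] pne have pgt: "r p < \<kappa> p" by simp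
  \<comment> \<open>Beyond \<open>M\<close> the sequences agree, and \<open>r\<close> stays below
    \<open>\<kappa> p\<close> along this parity, so the run ends.\<close>
  have ex: "\<kappa> (p + 2 * Suc M) \<noteq> \<kappa> p"
  proof -
    have "\<kappa> (p + 2 * Suc M) = r (p + 2 * Suc M)"
      using tail[of "p + 2 * Suc M"] tail[of "Suc (p + 2 * Suc M)"] by simp
    also have "\<dots> \<le> r p" by (rule rmono)
    finally show ?thesis using pgt by simp
  qed
  define h where "h = (LEAST h. \<kappa> (p + 2 * Suc h) \<noteq> \<kappa> p)"
  have h1: "\<kappa> (p + 2 * Suc h) \<noteq> \<kappa> p" unfolding h_def
    by (rule LeastI[of "\<lambda>h. \<kappa> (p + 2 * Suc h) \<noteq> \<kappa> p", OF ex])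
  have hconst: "\<kappa> (p + 2 * k) = \<kappa> p" if "k \<le> h" for k
  proof (cases k)
    case (Suc k')
    then have "k' < h" using that by simp
    then show ?thesis using not_less_Least[of k'] Suc unfolding h_def by blast
  qed simp
  define a where "a = p + 2 * h"
  have a2: "\<kappa> (a + 2) < \<kappa> p"
    using h1 mono[of p "Suc h"] by (simp add: a_def algebra_simps)
  have ka: "\<kappa> a = \<kappa> p" using hconst[of h] by (simp add: a_def)
  have rlt: "r (p + 2 * k) < \<kappa> p" for k using rmono[of p k] pgt by simp
  have strict1: "?R (Suc (p + 2 * k)) < ?S (Suc (p + 2 * k))" if "k \<le> h" for k
    using le[of "p + 2 * k"] rlt[of k] hconst[OF that] by simp
  \<comment> \<open>The first place after \<open>a + 1\<close> where the partial sums meet again;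
    before it there is a box to spare.\<close>
  define m where "m = (LEAST m. a + 1 < m \<and> ?S m = ?R m)"
  have m: "a + 1 < m" "?S m = ?R m"
  proof -
    have "a + 1 < M + a + 2 \<and> ?S (M + a + 2) = ?R (M + a + 2)"
      using tail[of "M + a + 2"] by simp
    from LeastI[of "\<lambda>m. a + 1 < m \<and> ?S m = ?R m", OF this]
    show "a + 1 < m" "?S m = ?R m" unfolding m_def by blast+
  qed
  have strict: "?R k < ?S k" if "a < k" "k < m" for k
  proof (cases "k = a + 1")
    case True
    then show ?thesis using strict1[of h] by (simp add: a_def)
  next
    case False
    then have "?S k \<noteq> ?R k" using not_less_Least[of k] that unfolding m_def by force
    then show ?thesis using le[of k] by simp
  qed
  \<comment> \<open>The partial sums close up at \<open>m\<close>, so the entry just before is a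
    deficit of \<open>\<kappa>\<close>.\<close>
  define e where "e = m - 1"
  have e: "m = Suc e" "a + 1 \<le> e" using m(1) by (simp_all add: e_def)
  have eM: "e < M" using strict[of e] e tail[of e] by (cases "e < M") auto
  have re: "\<kappa> e < r e" using strict[of e] m(2) e by simp
  let ?B = "\<lambda>b. b \<le> e \<and> even (e - b) \<and> \<kappa> b = \<kappa> e"
  define b where "b = (LEAST b. ?B b)"
  have b: "b \<le> e" "even (e - b)" "\<kappa> b = \<kappa> e"
    using LeastI[of ?B e] unfolding b_def by auto
  obtain g where g: "e = b + 2 * g" using b(1,2) by (metis dvd_def le_add_diff_inverse)
  have bconst: "\<kappa> (b + 2 * k) = \<kappa> e" if "k \<le> g" for k
  proof -
    have "\<kappa> (b + 2 * k + 2 * (g - k)) \<le> \<kappa> (b + 2 * k)" by (rule mono)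
    moreover have "b + 2 * k + 2 * (g - k) = e" using that g by simp
    ultimately show ?thesis using mono[of b k] b(3) by simp
  qed
  have rb: "\<kappa> b < r b" using rmono[of b g] re b(3) g by simp
  have pb: "p < b" using below[of b] rb pgt by (metis less_not_refl less_asym linorder_neqE_nat)
  have b2: "\<kappa> b < \<kappa> (b - 2)" if "2 \<le> b"
  proof -
    have "\<kappa> b \<le> \<kappa> (b - 2)" using \<kappa>2[of "b - 2"] le_add_diff_inverse2[OF that] by metis
    moreover have "\<kappa> (b - 2) \<noteq> \<kappa> e"
    proof
      assume "\<kappa> (b - 2) = \<kappa> e"
      moreover have "e - (b - 2) = 2 * (g + 1)" using g that by simp
      ultimately have "?B (b - 2)" using b(1) by simp
      from Least_le[of ?B, OF this] have "b \<le> b - 2" unfolding b_def .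
      then show False using that by simp
    qed
    ultimately show ?thesis using b(3) by simp
  qed
  show ?thesis
  proof (cases "a + 1 < b")
    case True
    \<comment> \<open>Between neighbours of one parity both entries change, so a difference of 2 is
      required.\<close>
    have gap: "\<kappa> b + 2 \<le> \<kappa> a" if "b = a + 2"
      using rb rlt[of "Suc h"] ka that by (simp add: a_def)
    have pos: "0 < \<kappa> a" using pgt ka by simp
    note S = sum_box_move[of a b \<kappa>, OF _ pos]
    have "two_step_antimono (box_move \<kappa> a b)"
      unfolding two_step_antimono_def
    proof
      fix i
      show "box_move \<kappa> a b (i + 2) \<le> box_move \<kappa> a b i"
        using \<kappa>2[of i] a2 ka b2 gap True
        by (cases "i = a"; cases "i = b"; cases "i + 2 = a"; cases "i + 2 = b")
          (auto simp: box_move_def)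
    qed
    moreover have "dominated r (box_move \<kappa> a b)" "dominated (box_move \<kappa> a b) \<kappa>"
      unfolding dominated_def
    proof safe
      fix k
      show "sum (box_move \<kappa> a b) {..<k} \<le> ?S k" using S[of k] True by simp
      show "?R k \<le> sum (box_move \<kappa> a b) {..<k}"
        using S[of k] le[of k] strict[of k] True b(1) e by (auto split: if_splits)
    qed
    moreover have "sum (box_move \<kappa> a b) {..<a + 1} < ?S (a + 1)"
      using S[of "a + 1"] True by simp
    moreover have "a + 2 \<le> b" "b < M" using True b(1) eM by simp_all
    ultimately show ?thesis using pos
      by (intro exI[of _ "box_move \<kappa> a b"]) blast
  next
    case False
    \<comment> \<open>An even distance would put \<open>b\<close> into the run starting at
      \<open>p\<close>, where \<open>\<kappa>\<close> exceeds \<open>r\<close>.\<close>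
    have "odd (b - p)"
    proof
      assume "even (b - p)"
      then obtain k where k: "b = p + 2 * k" using pb by (metis dvd_def le_add_diff_inverse less_imp_le)
      then have "k \<le> h" using False by (simp add: a_def)
      then show False using rlt[of k] hconst[of k] rb k by simp
    qed
    then obtain k where k: "b = p + 2 * k + 1" using pb by (metis oddE add.assoc le_add_diff_inverse less_imp_le)
    define c where "c = p + 2 * k"
    define l where "l = h - k"
    have kh: "k \<le> h" using False k by (simp add: a_def)
    then have cl: "c + 2 * l = a" by (simp add: c_def l_def a_def)
    have bc: "b = c + 1" by (simp add: k c_def)
    have evens: "\<kappa> (c + 2 * j) = \<kappa> p" if "j \<le> l" for j
      using hconst[of "k + j"] that kh by (simp add: c_def l_def algebra_simps)
    \<comment> \<open>These places lie between \<open>b\<close> and \<open>e\<close>, since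
      \<open>a + 1 \<le> e\<close>.\<close>
    have odds: "\<kappa> (c + 2 * j + 1) = \<kappa> b" if "j \<le> l" for j
    proof -
      have "c + 2 * j + 1 \<le> e" using that cl e by simp
      then show ?thesis using bconst[of j] b(3) g bc by simp
    qed
    have kc: "\<kappa> c = \<kappa> p" using evens[of 0] by simp
    have pos: "0 < \<kappa> (c + 2 * j)" if "j \<le> l" for j using evens[OF that] pgt by simp
    note S = sum_run_move[of l \<kappa> c, OF pos]
    have bb: "\<kappa> (c + 1) < \<kappa> (c - 1)" if "0 < c" using b2 that bc by simp
    have al: "\<kappa> (c + 2 * l + 2) < \<kappa> c" using a2 cl kc by simp
    have "two_step_antimono (run_move \<kappa> c l)"
      unfolding two_step_antimono_def
    proof
      fix i
      consider "i + 2 \<le> c" | "i + 1 = c" | "c \<le> i" "i + 2 \<le> c + 2 * l + 1" | "i = c + 2 * l"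
        | "i = c + 2 * l + 1" | "c + 2 * l + 1 < i" by linarith
      then show "run_move \<kappa> c l (i + 2) \<le> run_move \<kappa> c l i"
      proof cases
        case 1
        then show ?thesis using \<kappa>2[of i] by (auto simp: run_move_def)
      next
        case 2
        then have "c = Suc i" by simp
        then show ?thesis using bb by (simp add: run_move_def)
      next
        case 3
        then have "i + 2 - c = i - c + 2" by simp
        then show ?thesis using \<kappa>2[of i] 3 by (auto simp: run_move_def intro: diff_le_mono)
      next
        case 4
        then show ?thesis using al evens[of l] kc by (simp add: run_move_def)
      next
        case 5
        then show ?thesis using \<kappa>2[of i] by (simp add: run_move_def)
      next
        case 6
        then show ?thesis using \<kappa>2[of i] by (simp add: run_move_def)
      qed
    qed
    moreover have "dominated r (run_move \<kappa> c l)" "dominated (run_move \<kappa> c l) \<kappa>"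
      unfolding dominated_def
    proof safe
      fix i
      show "sum (run_move \<kappa> c l) {..<i} \<le> ?S i" using S[of i] by simp
      show "?R i \<le> sum (run_move \<kappa> c l) {..<i}"
      proof (cases "c < i \<and> i \<le> c + 2 * l + 1 \<and> odd (i - c)")
        case True
        then obtain j where j: "i - c = 2 * j + 1" by (elim conjE oddE)
        then have "j \<le> l" using True by linarith
        then have "i = Suc (p + 2 * (k + j))" "k + j \<le> h"
          using j True kh by (simp_all add: c_def l_def)
        then have "?R i < ?S i" using strict1[of "k + j"] by simp
        then show ?thesis using S[of i] by (simp split: if_splits)
      next
        case False
        then have "sum (run_move \<kappa> c l) {..<i} = ?S i" using S[of i] by (simp split: if_splits)
        then show ?thesis using le[of i] by simp
      qed
    qed
    moreover have "sum (run_move \<kappa> c l) {..<c + 1} < ?S (c + 1)"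
      using S[of "c + 1"] by simp
    moreover have "c + 2 * l + 1 < M" using cl e eM by simp
    moreover have "0 < \<kappa> c" using pos[of 0] by simp
    moreover have "\<forall>j\<le>l. \<kappa> (c + 2 * j) = \<kappa> c \<and> \<kappa> (c + 2 * j + 1) = \<kappa> (c + 1)"
      using evens odds kc bc by simp
    ultimately show ?thesis using al bb
      by (intro exI[of _ "run_move \<kappa> c l"]) blast
  qed
qed

section \<open>Partitions, their supports and their interleavings\<close>

lemma partition_nonzero_iff:
  assumes "is_partition \<mu>"
  shows "\<mu> i \<noteq> 0 \<longleftrightarrow> i < part_length \<mu>"
proof -
  let ?S = "{i. \<mu> i \<noteq> 0}"
  have fin: "finite ?S" and anti: "antimono \<mu>" using assms by (simp_all add: is_partition_def)
  show ?thesis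
  proof
    assume i: "\<mu> i \<noteq> 0"
    have "{..i} \<subseteq> ?S"
    proof
      fix j assume "j \<in> {..i}"
      then have "\<mu> i \<le> \<mu> j" using anti by (simp add: antimono_def)
      then show "j \<in> ?S" using i by simp
    qed
    then have "card {..i} \<le> card ?S" using fin by (rule card_mono[rotated])
    then show "i < part_length \<mu>" by (simp add: part_length_def)
  next
    assume i: "i < part_length \<mu>"
    show "\<mu> i \<noteq> 0"
    proof
      assume 0: "\<mu> i = 0"
      have "?S \<subseteq> {..<i}"
      proof
        fix j assume "j \<in> ?S"
        then show "j \<in> {..<i}"
          using 0 antimonoD[OF anti, of i j] by (cases "i \<le> j") auto
      qed
      then have "card ?S \<le> card {..<i}" by (rule card_mono[rotated]) simp
      then show False using i by (simp add: part_length_def)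
    qed
  qed
qed

lemma part_size_eq:
  assumes "is_partition \<mu>" "part_length \<mu> \<le> N"
  shows "part_size \<mu> = (\<Sum>i<N. \<mu> i)"
proof -
  have "{i. \<mu> i \<noteq> 0} = {..<part_length \<mu>}" using partition_nonzero_iff[OF assms(1)] by blast
  moreover have "\<forall>i\<in>{..<N} - {..<part_length \<mu>}. \<mu> i = 0"
    using partition_nonzero_iff[OF assms(1)] by blast
  ultimately show ?thesis
    unfolding part_size_def using assms(2) by (simp add: sum.mono_neutral_left)
qed

lemma is_partition_add:
  assumes "is_partition \<mu>" "is_partition \<nu>"
  shows "is_partition (\<lambda>i. \<mu> i + \<nu> i)"
proof -
  have "{i. \<mu> i + \<nu> i \<noteq> 0} = {i. \<mu> i \<noteq> 0} \<union> {i. \<nu> i \<noteq> 0}" by auto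
  then show ?thesis using assms by (auto simp: is_partition_def antimono_def intro: add_mono)
qed

lemma sum_interleave:
  "sum (interleave p q) {..<2 * k} = (\<Sum>i<k. p i + q i)"
  "sum (interleave p q) {..<2 * k + 1} = (\<Sum>i<k. p i + q i) + p k"
proof -
  show *: "sum (interleave p q) {..<2 * k} = (\<Sum>i<k. p i + q i)"
    by (induction k) (simp_all add: interleave_def)
  show "sum (interleave p q) {..<2 * k + 1} = (\<Sum>i<k. p i + q i) + p k"
    using * by (simp add: interleave_def)
qed

lemma bipartition_le_iff_dominated:
  "bipartition_le (\<rho>, \<sigma>) (\<mu>, \<nu>) \<longleftrightarrow> dominated (interleave \<rho> \<sigma>) (interleave \<mu> \<nu>)"
proof -
  have "dominated r \<kappa> \<longleftrightarrow> (\<forall>k. sum r {..<2 * k} \<le> sum \<kappa> {..<2 * k} \<and>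
      sum r {..<2 * k + 1} \<le> sum \<kappa> {..<2 * k + 1})" for r \<kappa> :: "nat \<Rightarrow> nat"
    unfolding dominated_def
  proof safe
    fix m :: nat
    assume *: "\<forall>k. sum r {..<2 * k} \<le> sum \<kappa> {..<2 * k} \<and>
      sum r {..<2 * k + 1} \<le> sum \<kappa> {..<2 * k + 1}"
    have "m = 2 * (m div 2) \<or> m = 2 * (m div 2) + 1" by presburger
    then show "sum r {..<m} \<le> sum \<kappa> {..<m}" using * by metis
  qed blast+
  then show ?thesis by (simp only: sum_interleave bipartition_le_def prod.case)
qed

lemma two_step_antimono_interleave:
  assumes "is_partition p" "is_partition q"
  shows "two_step_antimono (interleave p q)"
  using assms by (auto simp: two_step_antimono_def interleave_def is_partition_def antimono_def)

lemma sum_pairs: "(\<Sum>k<N. \<kappa> (2 * k) + \<kappa> (2 * k + 1)) = sum \<kappa> {..<2 * N}" for \<kappa> :: "nat \<Rightarrow> nat"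
  by (induction N) auto

context finite_dimensional_vector_space
begin

subsection \<open>Orbits of bipartitions and their closures\<close>

text \<open>\<open>i\<close> and \<open>j\<close> are the rows of the two boxes. A box taken from a
  first part is first turned into a second box of its own row and then moved on from there.\<close>

lemma box_move_closure:
  assumes inf: "infinite (UNIV :: 'a set)"
    and n: "sum \<kappa> {..<2 * N} = dimension"
    and ab: "a + 2 \<le> b" "b < 2 * N" "0 < \<kappa> a"
    and anti: "two_step_antimono (box_move \<kappa> a b)"
  shows "row_orbit N (\<lambda>k. box_move \<kappa> a b (2 * k)) (\<lambda>k. box_move \<kappa> a b (2 * k + 1))
    \<subseteq> row_closure N (\<lambda>k. \<kappa> (2 * k)) (\<lambda>k. \<kappa> (2 * k + 1))"
proof -
  define p where "p = (\<lambda>k. \<kappa> (2 * k))"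
  define q where "q = (\<lambda>k. \<kappa> (2 * k + 1))"
  define i where "i = a div 2"
  define j where "j = b div 2"
  let ?\<kappa> = "box_move \<kappa> a b"
  have ij: "i < N" "j < N" "i \<noteq> j" "i < j" using ab unfolding i_def j_def by presburger+
  \<comment> \<open>Monotonicity after the move supplies the strict inequalities between the rows
    before it.\<close>
  have "?\<kappa> (2 * i + 2 * (j - i)) \<le> ?\<kappa> (2 * i)" by (rule two_step_antimonoD[OF anti])
  then have mp: "?\<kappa> (2 * j) \<le> ?\<kappa> (2 * i)" using ij by (simp add: algebra_simps)
  have "?\<kappa> (2 * i + 1 + 2 * (j - i)) \<le> ?\<kappa> (2 * i + 1)" by (rule two_step_antimonoD[OF anti])
  moreover have "2 * i + 1 + 2 * (j - i) = 2 * j + 1" using ij by simp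
  ultimately have mq: "?\<kappa> (2 * j + 1) \<le> ?\<kappa> (2 * i + 1)" by metis
  have n1: "(\<Sum>k<N. p k + q k) = dimension" using n sum_pairs[of \<kappa> N] by (simp add: p_def q_def)
  have par: "2 * k \<noteq> Suc (2 * m)" "Suc (2 * m) \<noteq> 2 * k" for k m :: nat by presburger+
  \<comment> \<open>This intermediate pair need not be a bipartition: \<open>q i + 1\<close> may
    exceed the second part of the preceding row.\<close>
  let ?P = "p(i := p i - 1)" and ?Q = "q(i := q i + 1)"
  have drop: "row_orbit N ?P ?Q \<subseteq> row_closure N p q" if "0 < p i"
    by (rule row_drop[OF inf]) (use that in auto)
  have n2: "(\<Sum>k<N. ?P k + ?Q k) = dimension" if "0 < p i"
    unfolding n1[symmetric] by (rule sum.cong) (use that in auto)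
  have "row_orbit N (\<lambda>k. ?\<kappa> (2 * k)) (\<lambda>k. ?\<kappa> (2 * k + 1)) \<subseteq> row_closure N p q"
  proof (cases "even a"; cases "even b")
    assume e: "even a" "even b"
    then have a: "a = 2 * i" "b = 2 * j" by (simp_all add: i_def j_def)
    have c: "0 < p i" "p j + 1 \<le> p i - 1" "q j \<le> q i"
      using ab(3) mp mq ij by (simp_all add: a p_def q_def box_move_def)
    have r: "row_orbit N (?P(j := ?P j + 1)) (?Q(i := ?Q i - 1)) \<subseteq> row_closure N ?P ?Q"
      by (rule row_move_second_first[OF inf n2[OF c(1)] ij(1-3)]) (use c ij in auto)
    have 1: "(\<lambda>k. ?\<kappa> (2 * k)) = ?P(j := ?P j + 1)"
      using ij by (auto simp: a p_def box_move_def)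
    have 2: "(\<lambda>k. ?\<kappa> (2 * k + 1)) = ?Q(i := ?Q i - 1)"
      by (auto simp: a q_def box_move_def par)
    show ?thesis unfolding 1 2 by (rule row_closure_trans[OF r drop[OF c(1)]])
  next
    assume e: "even a" "odd b"
    then have a: "a = 2 * i" "b = 2 * j + 1" by (simp_all add: i_def j_def)
    have c: "0 < p i" "p j \<le> p i - 1" "q j + 1 \<le> q i"
      using ab(3) mp mq ij by (simp_all add: a p_def q_def box_move_def)
    have r: "row_orbit N ?P (?Q(i := ?Q i - 1, j := ?Q j + 1)) \<subseteq> row_closure N ?P ?Q"
      by (rule row_move_second[OF inf n2[OF c(1)] ij(1-3)]) (use c ij in auto)
    have 1: "(\<lambda>k. ?\<kappa> (2 * k)) = ?P"
      by (auto simp: a p_def box_move_def par)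
    have 2: "(\<lambda>k. ?\<kappa> (2 * k + 1)) = ?Q(i := ?Q i - 1, j := ?Q j + 1)"
      using ij by (auto simp: a q_def box_move_def par)
    show ?thesis unfolding 1 2 by (rule row_closure_trans[OF r drop[OF c(1)]])
  next
    assume e: "odd a" "even b"
    then have a: "a = 2 * i + 1" "b = 2 * j" by (simp_all add: i_def j_def)
    have c: "p j + 1 \<le> p i" "q j \<le> q i - 1" "0 < q i"
      using ab(3) mp mq ij by (simp_all add: a p_def q_def box_move_def)
    have r: "row_orbit N (p(j := p j + 1)) (q(i := q i - 1)) \<subseteq> row_closure N p q"
      by (rule row_move_second_first[OF inf n1 ij(1-3)]) (use c ij in auto)
    have 1: "(\<lambda>k. ?\<kappa> (2 * k)) = p(j := p j + 1)"
      by (auto simp: a p_def box_move_def par)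
    have 2: "(\<lambda>k. ?\<kappa> (2 * k + 1)) = q(i := q i - 1)"
      by (auto simp: a q_def box_move_def par)
    show ?thesis unfolding 1 2 by (rule r)
  next
    assume e: "odd a" "odd b"
    then have a: "a = 2 * i + 1" "b = 2 * j + 1" by (simp_all add: i_def j_def)
    have c: "p j \<le> p i" "q j + 1 \<le> q i - 1"
      using ab(3) mp mq ij by (simp_all add: a p_def q_def box_move_def)
    have r: "row_orbit N p (q(i := q i - 1, j := q j + 1)) \<subseteq> row_closure N p q"
      by (rule row_move_second[OF inf n1 ij(1-3)]) (use c ij in auto)
    have 1: "(\<lambda>k. ?\<kappa> (2 * k)) = p"
      by (auto simp: a p_def box_move_def par)
    have 2: "(\<lambda>k. ?\<kappa> (2 * k + 1)) = q(i := q i - 1, j := q j + 1)"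
      using ij by (auto simp: a q_def box_move_def)
    show ?thesis unfolding 1 2 by (rule r)
  qed
  then show ?thesis by (simp add: p_def q_def)
qed

text \<open>For even \<open>c\<close> every box stays in its row and \<open>row_drop\<close>
  applies. For odd \<open>c\<close> boxes pass from \<open>q k\<close> to \<open>p (k + 1)\<close>,
  so the rows strictly between \<open>i\<close> and \<open>m\<close> gain a first box and lose a
  second one; row \<open>i\<close> absorbs these changes, leaving one move from \<open>q i\<close>
  to \<open>p m\<close>.\<close>

lemma run_move_closure:
  assumes inf: "infinite (UNIV :: 'a set)"
    and n: "sum \<kappa> {..<2 * N} = dimension"
    and c: "c + 2 * l + 1 < 2 * N" "0 < \<kappa> c"
    and const: "\<And>j. j \<le> l \<Longrightarrow> \<kappa> (c + 2 * j) = \<kappa> c \<and> \<kappa> (c + 2 * j + 1) = \<kappa> (c + 1)"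
    and last: "\<kappa> (c + 2 * l + 2) < \<kappa> c" and first: "0 < c \<Longrightarrow> \<kappa> (c + 1) < \<kappa> (c - 1)"
  shows "row_orbit N (\<lambda>k. run_move \<kappa> c l (2 * k)) (\<lambda>k. run_move \<kappa> c l (2 * k + 1))
    \<subseteq> row_closure N (\<lambda>k. \<kappa> (2 * k)) (\<lambda>k. \<kappa> (2 * k + 1))"
proof (cases "even c")
  case True
  have pos: "0 < \<kappa> (2 * k)" if "c \<le> 2 * k" "2 * k \<le> c + 2 * l + 1" for k
  proof -
    have "2 * k = c + 2 * (k - c div 2)" "k - c div 2 \<le> l" using that True by presburger+
    then show ?thesis using const[of "k - c div 2"] c(2) by simp
  qed
  show ?thesis
  proof (rule row_drop[OF inf])
    fix k
    have "c \<le> 2 * k \<longleftrightarrow> c \<le> 2 * k + 1" "2 * k \<le> c + 2 * l + 1 \<longleftrightarrow> 2 * k + 1 \<le> c + 2 * l + 1"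
      using True by presburger+
    then show "run_move \<kappa> c l (2 * k) \<le> \<kappa> (2 * k) \<and>
        run_move \<kappa> c l (2 * k) + run_move \<kappa> c l (2 * k + 1) = \<kappa> (2 * k) + \<kappa> (2 * k + 1)"
      using True pos[of k] by (auto simp: run_move_def)
  qed
next
  case False
  define p where "p = (\<lambda>k. \<kappa> (2 * k))"
  define q where "q = (\<lambda>k. \<kappa> (2 * k + 1))"
  obtain i where i: "c = 2 * i + 1" using False by (metis oddE)
  define m where "m = i + l + 1"
  have im: "i < N" "m < N" "i \<noteq> m" using c(1) by (simp_all add: i m_def)
  let ?p = "\<lambda>k. run_move \<kappa> c l (2 * k)" and ?q = "\<lambda>k. run_move \<kappa> c l (2 * k + 1)"
  let ?M = "{i<..<m}"
  have n1: "(\<Sum>k<N. p k + q k) = dimension" using n sum_pairs[of \<kappa> N] by (simp add: p_def q_def)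
  have p': "?p k = (if k \<in> {i<..m} then p k + 1 else p k)" for k
  proof -
    have "odd (2 * k - c)" if "c \<le> 2 * k" using that i by presburger
    then show ?thesis by (auto simp: run_move_def p_def i m_def)
  qed
  have q': "?q k = (if k \<in> {i..<m} then q k - 1 else q k)" for k
    by (auto simp: run_move_def q_def i m_def)
  have qc: "q k = q i" if "k \<in> {i..<m}" for k
  proof -
    have "2 * k + 1 = c + 2 * (k - i)" "k - i \<le> l" using that by (auto simp: i m_def)
    then show ?thesis using const[of "k - i"] by (simp add: q_def i)
  qed
  have pc: "p k = p m" if "k \<in> {i<..m}" for k
  proof -
    have *: "p k = \<kappa> (c + 1)" if "k \<in> {i<..m}" for k
    proof -
      have "2 * k = c + 2 * (k - i - 1) + 1" "k - i - 1 \<le> l" using that by (auto simp: i m_def)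
      then show ?thesis using const[of "k - i - 1"] by (metis p_def)
    qed
    show ?thesis using *[OF that] *[of m] im by (auto simp: m_def)
  qed
  \<comment> \<open>An odd \<open>c\<close> is positive, so \<open>first\<close> applies.\<close>
  have pi: "p m < p i" using first const[of l] by (simp add: p_def i m_def algebra_simps)
  have qi: "q m < q i" using last by (simp add: q_def i m_def algebra_simps)
  have "row_orbit N ?p ?q \<subseteq> row_orbit N (\<lambda>k. if k \<in> ?M then p k else ?p k) (\<lambda>k. if k \<in> ?M then q k else ?q k)"
  proof (rule row_absorb_set[of _ _ i])
    fix j assume j: "j \<in> ?M"
    then have "p j = p m" "q j = q i" by (auto intro: pc qc)
    then show "?p j \<le> ?p i \<and> ?q i \<le> ?q j \<and> p j \<le> ?p i \<and> ?q i \<le> q j \<and> p j + q j = ?p j + ?q j"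
      unfolding p' q' using j pi qi by auto
  qed (use im in auto)
  also have "(\<lambda>k. if k \<in> ?M then p k else ?p k) = p(m := p m + 1)"
    unfolding p' by (rule ext) (auto simp: m_def)
  also have "(\<lambda>k. if k \<in> ?M then q k else ?q k) = q(i := q i - 1)"
    unfolding q' by (rule ext) (auto simp: m_def)
  also have "row_orbit N (p(m := p m + 1)) (q(i := q i - 1)) \<subseteq> row_closure N p q"
    by (rule row_move_second_first[OF inf n1 im pi qi])
  finally show ?thesis by (simp add: p_def q_def)
qed

text \<open>Induction on the sum of all partial sums, which each \<open>dominance_step\<close>
  lowers. Agreement of the tails confines the moves to the first \<open>2 * N\<close> entries, that
  is, to \<open>N\<close> rows.\<close>

lemma dominated_closure:
  assumes inf: "infinite (UNIV :: 'a set)"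
    and "two_step_antimono \<kappa>" and r: "two_step_antimono r" and "dominated r \<kappa>"
    and "\<And>m. 2 * N \<le> m \<Longrightarrow> sum \<kappa> {..<m} = sum r {..<m}"
    and "sum \<kappa> {..<2 * N} = dimension"
  shows "row_orbit N (\<lambda>k. r (2 * k)) (\<lambda>k. r (2 * k + 1))
    \<subseteq> row_closure N (\<lambda>k. \<kappa> (2 * k)) (\<lambda>k. \<kappa> (2 * k + 1))"
  using assms(2,4-6)
proof (induction "\<Sum>m<2 * N. sum \<kappa> {..<m}" arbitrary: \<kappa> rule: less_induct)
  case less
  show ?case
  proof (cases "\<kappa> = r")
    case True
    then show ?thesis using row_orbit_subset_closure by simp
  next
    case False
    have tail0: "\<forall>m\<ge>2 * N. sum \<kappa> {..<m} = sum r {..<m}" using less.prems(3) by blast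
    obtain \<kappa>' where \<kappa>': "two_step_antimono \<kappa>'" "dominated r \<kappa>'" "dominated \<kappa>' \<kappa>"
      "\<exists>m. sum \<kappa>' {..<m} < sum \<kappa> {..<m}"
      and move: "(\<exists>a b. \<kappa>' = box_move \<kappa> a b \<and> a + 2 \<le> b \<and> b < 2 * N \<and> 0 < \<kappa> a) \<or>
     (\<exists>c l. \<kappa>' = run_move \<kappa> c l \<and> c + 2 * l + 1 < 2 * N \<and> 0 < \<kappa> c \<and>
       (\<forall>j\<le>l. \<kappa> (c + 2 * j) = \<kappa> c \<and> \<kappa> (c + 2 * j + 1) = \<kappa> (c + 1)) \<and>
       \<kappa> (c + 2 * l + 2) < \<kappa> c \<and> (0 < c \<longrightarrow> \<kappa> (c + 1) < \<kappa> (c - 1)))"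
      using dominance_step[OF less.prems(1) r less.prems(2) tail0 False]
      by (elim exE conjE) blast
    have le: "sum r {..<m} \<le> sum \<kappa>' {..<m}" "sum \<kappa>' {..<m} \<le> sum \<kappa> {..<m}" for m
      using \<kappa>'(2,3) by (simp_all add: dominated_def)
    have tail: "sum \<kappa>' {..<m} = sum r {..<m}" if "2 * N \<le> m" for m
      using le[of m] less.prems(3)[OF that] by simp
    obtain m where m: "sum \<kappa>' {..<m} < sum \<kappa> {..<m}" using \<kappa>'(4) by blast
    then have "m < 2 * N" using tail[of m] less.prems(3)[of m] by (cases "m < 2 * N") auto
    then have "(\<Sum>m<2 * N. sum \<kappa>' {..<m}) < (\<Sum>m<2 * N. sum \<kappa> {..<m})"
      using m le by (intro sum_strict_mono_ex1) auto
    moreover have "sum \<kappa>' {..<2 * N} = dimension"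
      using tail[of "2 * N"] less.prems(3)[of "2 * N"] less.prems(4) by simp
    ultimately have "row_orbit N (\<lambda>k. r (2 * k)) (\<lambda>k. r (2 * k + 1))
        \<subseteq> row_closure N (\<lambda>k. \<kappa>' (2 * k)) (\<lambda>k. \<kappa>' (2 * k + 1))"
      using \<kappa>' tail by (intro less.hyps) auto
    moreover have "row_orbit N (\<lambda>k. \<kappa>' (2 * k)) (\<lambda>k. \<kappa>' (2 * k + 1))
        \<subseteq> row_closure N (\<lambda>k. \<kappa> (2 * k)) (\<lambda>k. \<kappa> (2 * k + 1))"
      using move
    proof (elim disjE exE conjE)
      fix a b assume "\<kappa>' = box_move \<kappa> a b" "a + 2 \<le> b" "b < 2 * N" "0 < \<kappa> a"
      then show ?thesis using box_move_closure[OF inf less.prems(4), of a b] \<kappa>'(1) by blast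
    next
      fix c l assume "\<kappa>' = run_move \<kappa> c l" "c + 2 * l + 1 < 2 * N" "0 < \<kappa> c"
        "\<forall>j\<le>l. \<kappa> (c + 2 * j) = \<kappa> c \<and> \<kappa> (c + 2 * j + 1) = \<kappa> (c + 1)"
        "\<kappa> (c + 2 * l + 2) < \<kappa> c" "0 < c \<longrightarrow> \<kappa> (c + 1) < \<kappa> (c - 1)"
      then show ?thesis using run_move_closure[OF inf less.prems(4), of c l] by blast
    qed
    ultimately show ?thesis by (rule row_closure_trans)
  qed
qed

section \<open>Model points, and row orbits compared with enhanced orbits\<close>

text \<open>A bijection \<open>h\<close> indexes \<open>Basis\<close> by the boxes, and
  \<open>x\<close> is defined as the shift along each row.\<close>

lemma row_orbit_nonempty:
  assumes n: "(\<Sum>i<N. p i + q i) = dimension"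
  shows "row_orbit N p q \<noteq> {}"
proof -
  define l where "l = (\<lambda>i. p i + q i)"
  let ?J = "row_index N l"
  have "card ?J = card Basis" using n by (simp add: card_row_index l_def dimension_def)
  then obtain h where h: "bij_betw h ?J Basis"
    using finite_same_card_bij[OF finite_row_index finite_Basis] by blast
  define f where "f = (\<lambda>(i, k). if Suc k < l i then h (i, Suc k) else 0)"
  obtain x where x: "endo x" and xb: "\<forall>b\<in>Basis. x b = f (the_inv_into ?J h b)"
    using exists_endo[OF independent_Basis, of "\<lambda>b. f (the_inv_into ?J h b)"] by blast
  have xh: "x (h J) = f J" if "J \<in> ?J" for J
    using xb h that by (metis bij_betw_apply bij_betw_imp_inj_on the_inv_into_f_f)
  define w where "w = (\<lambda>i. if 0 < l i then h (i, 0) else 0)"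
  have pow: "(x ^^ k) (w i) = h (i, k)" if "i < N" "k < l i" for i k
    using that(2)
  proof (induction k)
    case (Suc k)
    then have "(i, k) \<in> ?J" using that by (simp add: row_index_def)
    then show ?case using Suc by (simp add: xh f_def)
  qed (simp add: w_def)
  have "row_gens N p q x (\<Sum>i<N. (x ^^ q i) (w i)) w"
  proof (rule row_gensI[OF x])
    show "(x ^^ (p i + q i)) (w i) = 0" if i: "i < N" for i
    proof (cases "l i")
      case (Suc k)
      then have "(i, k) \<in> ?J" using i by (simp add: row_index_def)
      then have "x (h (i, k)) = 0" using Suc by (simp add: xh f_def)
      then have "(x ^^ l i) (w i) = 0" using pow[OF i, of k] Suc by simp
      then show ?thesis by (simp add: l_def)
    qed (simp add: l_def w_def)
    show "u \<in> W" if W: "subspace W" "x ` W \<subseteq> W" and mem: "\<And>i. i < N \<Longrightarrow> w i \<in> W" for W u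
    proof -
      have "Basis \<subseteq> W"
      proof
        fix b assume "b \<in> Basis"
        then obtain J where "J \<in> ?J" "b = h J" using h by (auto simp: bij_betw_def)
        then obtain i k where ik: "b = h (i, k)" "i < N" "k < l i" by (auto simp: row_index_def)
        then have "b = (x ^^ k) (w i)" using pow by simp
        then show "b \<in> W" using funpow_mem[OF W(2) mem[OF ik(2)]] by simp
      qed
      then have "span Basis \<subseteq> W" using W(1) by (rule span_minimal)
      then show ?thesis using span_Basis by blast
    qed
  qed simp
  then show ?thesis by (auto simp: row_orbit_def)
qed

lemma row_orbit_subset_enhanced_orbit:
  assumes \<mu>: "is_partition \<mu>" and \<nu>: "is_partition \<nu>"
    and N: "part_length (\<lambda>i. \<mu> i + \<nu> i) \<le> N" and n: "(\<Sum>i<N. \<mu> i + \<nu> i) = dimension"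
  shows "row_orbit N \<mu> \<nu> \<subseteq> enhanced_orbit scale (\<mu>, \<nu>)"
proof clarify
  fix v x assume vx: "(v, x) \<in> row_orbit N \<mu> \<nu>"
  then obtain w where w: "row_gens N \<mu> \<nu> x v w" by (auto simp: row_orbit_def)
  then have kill: "\<And>i. i < N \<Longrightarrow> (x ^^ (\<mu> i + \<nu> i)) (w i) = 0"
    and v: "v = (\<Sum>i<N. (x ^^ \<nu> i) (w i))" by (auto simp: row_gens_def)
  define l where "l = (\<lambda>i. \<mu> i + \<nu> i)"
  note nz = partition_nonzero_iff[OF is_partition_add[OF \<mu> \<nu>]]
  let ?L = "part_length (\<lambda>i. \<mu> i + \<nu> i)"
  let ?I = "SIGMA i:{..<?L}. {1..\<mu> i + \<nu> i}"
  let ?J = "row_index N (\<lambda>i. \<mu> i + \<nu> i)"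
  \<comment> \<open>Rows are read backwards, so that \<open>x\<close> lowers \<open>j\<close> and
    \<open>e i (\<mu> i)\<close> becomes \<open>x^(\<nu> i) (w i)\<close>.\<close>
  define e where "e = (\<lambda>i j. (x ^^ (l i - j)) (w i))"
  define g where "g = (\<lambda>(i, k). (x ^^ k) (w i))"
  define h where "h = (\<lambda>(i, j). (i :: nat, l i - j))"
  note basis = row_gens_basis[OF w n, folded g_def]
  have eh: "(\<lambda>(i, j). e i j) = g \<circ> h" by (auto simp: e_def g_def h_def)
  have hinj: "inj_on h ?I" by (auto simp: inj_on_def h_def l_def)
  have him: "h ` ?I = ?J"
  proof
    show "h ` ?I \<subseteq> ?J" using N by (auto simp: h_def row_index_def l_def)
    show "?J \<subseteq> h ` ?I"
    proof clarify
      fix i k assume "(i, k) \<in> ?J"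
      then have ik: "i < N" "k < l i" by (auto simp: row_index_def l_def)
      then have "\<mu> i + \<nu> i \<noteq> 0" unfolding l_def by linarith
      then have "i < ?L" using nz[of i] by blast
      then have "(i, l i - k) \<in> ?I" using ik by (auto simp: l_def)
      moreover have "h (i, l i - k) = (i, k)" using ik by (simp add: h_def)
      ultimately show "(i, k) \<in> h ` ?I" by (metis imageI)
    qed
  qed
  have im: "(\<lambda>(i, j). e i j) ` ?I = g ` ?J" unfolding eh him[symmetric] by (rule image_comp[symmetric])
  have e_inj: "inj_on (\<lambda>(i, j). e i j) ?I"
    unfolding eh by (rule comp_inj_on[OF hinj]) (simp only: him basis)
  have step: "x (e i j) = (if j > 1 then e i (j - 1) else 0)"
    if ij: "i < ?L" "j \<in> {1..\<mu> i + \<nu> i}" for i j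
  proof -
    have "x (e i j) = (x ^^ Suc (l i - j)) (w i)" by (simp add: e_def)
    also have "Suc (l i - j) = l i - (j - 1)"
      using ij(2) unfolding l_def atLeastAtMost_iff by linarith
    finally have "x (e i j) = (x ^^ (l i - (j - 1))) (w i)" .
    moreover have "(x ^^ l i) (w i) = 0" using kill[of i] ij(1) N by (simp add: l_def)
    ultimately show "x (e i j) = (if j > 1 then e i (j - 1) else 0)"
      using ij(2) by (auto simp: e_def)
  qed
  have e_step: "\<forall>(i, j)\<in>?I. x (e i j) = (if j > 1 then e i (j - 1) else 0)"
  proof
    fix ij assume "ij \<in> ?I"
    then obtain i j where ij: "ij = (i, j)" "i < ?L" "j \<in> {1..\<mu> i + \<nu> i}" by auto
    show "case ij of (i, j) \<Rightarrow> x (e i j) = (if j > 1 then e i (j - 1) else 0)"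
      unfolding ij(1) prod.case by (rule step[OF ij(2,3)])
  qed
  have e_sum: "v = (\<Sum>i<part_length \<mu>. e i (\<mu> i))"
  proof -
    have "(\<Sum>i<part_length \<mu>. e i (\<mu> i)) = (\<Sum>i<part_length \<mu>. (x ^^ \<nu> i) (w i))"
      by (simp add: e_def l_def)
    also have "\<dots> = v"
      unfolding v
    proof (rule sum.mono_neutral_left)
      show "{..<part_length \<mu>} \<subseteq> {..<N}"
      proof (rule subsetI)
        fix i assume "i \<in> {..<part_length \<mu>}"
        then show "i \<in> {..<N}" using partition_nonzero_iff[OF \<mu>, of i] nz[of i] N by simp
      qed
      \<comment> \<open>In rows without first boxes \<open>x^(\<nu> i)\<close> already kills the
        generator.\<close>
      show "\<forall>i\<in>{..<N} - {..<part_length \<mu>}. (x ^^ \<nu> i) (w i) = 0"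
      proof
        fix i assume i: "i \<in> {..<N} - {..<part_length \<mu>}"
        then have "\<mu> i = 0" using partition_nonzero_iff[OF \<mu>, of i] by blast
        then show "(x ^^ \<nu> i) (w i) = 0" using kill[of i] i by simp
      qed
    qed simp
    finally show ?thesis by simp
  qed
  have cone: "(v, x) \<in> enhanced_cone scale" using row_orbit_subset_cone vx by blast
  have e_basis: "independent ((\<lambda>(i, j). e i j) ` ?I)" "span ((\<lambda>(i, j). e i j) ` ?I) = UNIV"
    unfolding im by (fact basis)+
  show "(v, x) \<in> enhanced_orbit scale (\<mu>, \<nu>)"
    unfolding enhanced_orbit_def Let_def prod.case mem_Collect_eq
    by (intro conjI exI[of _ e] cone e_inj e_basis e_step e_sum)
qed

lemma enhanced_orbit_subset_row_orbit:
  assumes \<mu>: "is_partition \<mu>" and \<nu>: "is_partition \<nu>"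
    and N: "part_length (\<lambda>i. \<mu> i + \<nu> i) \<le> N"
  shows "enhanced_orbit scale (\<mu>, \<nu>) \<subseteq> row_orbit N \<mu> \<nu>"
proof clarify
  let ?L = "part_length (\<lambda>i. \<mu> i + \<nu> i)"
  let ?I = "SIGMA i:{..<?L}. {1..\<mu> i + \<nu> i}"
  note nz = partition_nonzero_iff[OF is_partition_add[OF \<mu> \<nu>]]
  fix v x assume "(v, x) \<in> enhanced_orbit scale (\<mu>, \<nu>)"
  then obtain e where cone: "(v, x) \<in> enhanced_cone scale"
    and span: "span ((\<lambda>(i, j). e i j) ` ?I) = UNIV"
    and xe: "\<forall>(i, j)\<in>?I. x (e i j) = (if j > 1 then e i (j - 1) else 0)"
    and v: "v = (\<Sum>i<part_length \<mu>. e i (\<mu> i))"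
    unfolding enhanced_orbit_def Let_def by auto
  have x: "endo x" using cone by (auto simp: enhanced_cone_def nilpotent_endos_def)
  define l where "l = (\<lambda>i. \<mu> i + \<nu> i)"
  \<comment> \<open>The top vector of each row generates it; rows from \<open>?L\<close> up to
    \<open>N\<close> are padding with generator 0.\<close>
  define w where "w = (\<lambda>i. if i < ?L then e i (l i) else 0)"
  have step: "x (e i j) = (if j > 1 then e i (j - 1) else 0)" if "i < ?L" "1 \<le> j" "j \<le> l i" for i j
    using xe that by (auto simp: l_def)
  have pow: "(x ^^ k) (w i) = e i (l i - k)" if "i < ?L" "k < l i" for i k
    using that(2)
  proof (induction k)
    case (Suc k)
    then have "(x ^^ Suc k) (w i) = x (e i (l i - k))" by simp
    also have "1 < l i - k" using Suc.prems by simp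
    then have "x (e i (l i - k)) = e i (l i - k - 1)" using step[OF that(1), of "l i - k"] by simp
    finally show ?case by simp
  qed (simp add: w_def that)
  have w0: "w i = 0" if "\<not> i < ?L" for i using that by (simp add: w_def)
  have kill: "(x ^^ l i) (w i) = 0" for i
  proof (cases "i < ?L")
    case True
    then obtain k where k: "l i = Suc k" using nz[of i] by (auto simp: l_def gr0_conv_Suc)
    have "(x ^^ l i) (w i) = x (e i 1)" using pow[OF True, of k] k by simp
    then show ?thesis using step[OF True, of 1] k by simp
  qed (simp add: w0 powD[OF x])
  have "row_gens N \<mu> \<nu> x v w"
  proof (rule row_gensI[OF x])
    show "(x ^^ (\<mu> i + \<nu> i)) (w i) = 0" for i using kill[of i] by (simp add: l_def)
    show "u \<in> W" if W: "subspace W" "x ` W \<subseteq> W" and mem: "\<And>i. i < N \<Longrightarrow> w i \<in> W" for W u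
    proof -
      have "(\<lambda>(i, j). e i j) ` ?I \<subseteq> W"
      proof clarify
        fix i j assume ij: "i < ?L" "j \<in> {1..\<mu> i + \<nu> i}"
        have "l i - j < l i" "l i - (l i - j) = j"
          using ij(2) unfolding l_def atLeastAtMost_iff by linarith+
        then have "(x ^^ (l i - j)) (w i) = e i j" using pow[OF ij(1), of "l i - j"] by simp
        moreover have "(x ^^ (l i - j)) (w i) \<in> W"
          using ij N by (intro funpow_mem[OF W(2) mem]) simp
        ultimately show "e i j \<in> W" by simp
      qed
      then have "span ((\<lambda>(i, j). e i j) ` ?I) \<subseteq> W" using W(1) by (rule span_minimal)
      then show ?thesis using span by blast
    qed
    have "(\<Sum>i<part_length \<mu>. e i (\<mu> i)) = (\<Sum>i<part_length \<mu>. (x ^^ \<nu> i) (w i))"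
    proof (rule sum.cong)
      fix i assume "i \<in> {..<part_length \<mu>}"
      then have "\<mu> i \<noteq> 0" using partition_nonzero_iff[OF \<mu>] by simp
      then show "e i (\<mu> i) = (x ^^ \<nu> i) (w i)"
        using pow[of i "\<nu> i"] nz[of i] by (simp add: l_def)
    qed simp
    also have "\<dots> = (\<Sum>i<N. (x ^^ \<nu> i) (w i))"
    proof (rule sum.mono_neutral_left)
      show "{..<part_length \<mu>} \<subseteq> {..<N}"
      proof (rule subsetI)
        fix i assume "i \<in> {..<part_length \<mu>}"
        then show "i \<in> {..<N}" using partition_nonzero_iff[OF \<mu>, of i] nz[of i] N by simp
      qed
      show "\<forall>i\<in>{..<N} - {..<part_length \<mu>}. (x ^^ \<nu> i) (w i) = 0"
      proof
        fix i assume i: "i \<in> {..<N} - {..<part_length \<mu>}"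
        then have "\<mu> i = 0" using partition_nonzero_iff[OF \<mu>, of i] by blast
        then show "(x ^^ \<nu> i) (w i) = 0" using kill[of i] by (simp add: l_def)
      qed
    qed simp
    finally show "v = (\<Sum>i<N. (x ^^ \<nu> i) (w i))" unfolding v .
  qed
  then show "(v, x) \<in> row_orbit N \<mu> \<nu>" by (auto simp: row_orbit_def)
qed

text \<open>A cyclic family independent at a point of the smaller orbit is independent, with the
  same \<open>w\<close>, at some point of the larger one, where its size is bounded. Taking
  \<open>r = 0\<close> leaves \<open>v\<close> out, so both kinds of partial sums are
  covered.\<close>

lemma row_closure_imp_sums_le:
  assumes sub: "row_orbit N \<rho> \<sigma> \<subseteq> row_closure N \<mu> \<nu>"
    and n: "(\<Sum>i<N. \<rho> i + \<sigma> i) = dimension" and k: "k < N"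
    and anti: "antimono \<mu>" "antimono \<nu>" and r: "r \<le> \<rho> k"
  shows "(\<Sum>i<k. \<rho> i + \<sigma> i) + r \<le> (\<Sum>i<k. \<mu> i + \<nu> i) + (if r = 0 then 0 else \<mu> k)"
proof -
  obtain v x w where w: "row_gens N \<rho> \<sigma> x v w"
    using row_orbit_nonempty[OF n] by (auto simp: row_orbit_def)
  then have "(v, x) \<in> zariski scale closure_of row_orbit N \<mu> \<nu>"
    using sub by (auto simp: row_orbit_def row_closure_def)
  from indep_family_closure[OF finite_cyclic_index regular_cyclic_family
      cyclic_family_independent[OF w n k r] this row_orbit_subset_cone]
  obtain v' x' where "(v', x') \<in> row_orbit N \<mu> \<nu>"
    and ind: "indep_family (cyclic_index k (\<lambda>i. \<rho> i + \<sigma> i) r) (\<lambda>b. cyclic_family k w b (v', x'))"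
    by auto
  then obtain z where "row_gens N \<mu> \<nu> x' v' z" by (auto simp: row_orbit_def)
  from cyclic_family_card[OF this k anti ind] show ?thesis .
qed

lemma orbit_closure_iff:
  assumes inf: "infinite (UNIV :: 'a set)"
    and \<rho>\<sigma>: "(\<rho>, \<sigma>) \<in> bipartitions dimension" and \<mu>\<nu>: "(\<mu>, \<nu>) \<in> bipartitions dimension"
  shows "enhanced_orbit scale (\<rho>, \<sigma>) \<subseteq> zariski scale closure_of enhanced_orbit scale (\<mu>, \<nu>)
    \<longleftrightarrow> bipartition_le (\<rho>, \<sigma>) (\<mu>, \<nu>)"
proof -
  have parts: "is_partition \<rho>" "is_partition \<sigma>" "is_partition \<mu>" "is_partition \<nu>"
    and sizes: "part_size \<rho> + part_size \<sigma> = dimension" "part_size \<mu> + part_size \<nu> = dimension"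
    using \<rho>\<sigma> \<mu>\<nu> by (auto simp: bipartitions_def)
  \<comment> \<open>Enough rows for both bipartitions; every \<open>N \<ge> M\<close> describes the
    same orbits, padded by empty rows.\<close>
  define M where "M = part_length \<rho> + part_length \<sigma> + part_length \<mu> + part_length \<nu> +
    part_length (\<lambda>i. \<rho> i + \<sigma> i) + part_length (\<lambda>i. \<mu> i + \<nu> i)"
  have total: "(\<Sum>i<N. \<rho> i + \<sigma> i) = dimension" "(\<Sum>i<N. \<mu> i + \<nu> i) = dimension" if "M \<le> N" for N
    using sizes that part_size_eq[OF parts(1), of N] part_size_eq[OF parts(2), of N]
      part_size_eq[OF parts(3), of N] part_size_eq[OF parts(4), of N]
    by (simp_all add: M_def sum.distrib)
  have orbits: "enhanced_orbit scale (\<rho>, \<sigma>) = row_orbit N \<rho> \<sigma>"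
    "enhanced_orbit scale (\<mu>, \<nu>) = row_orbit N \<mu> \<nu>" if "M \<le> N" for N
    using that total[OF that] parts
    by (intro equalityI enhanced_orbit_subset_row_orbit row_orbit_subset_enhanced_orbit;
        simp add: M_def)+
  show ?thesis
  proof
    assume sub: "enhanced_orbit scale (\<rho>, \<sigma>) \<subseteq> zariski scale closure_of enhanced_orbit scale (\<mu>, \<nu>)"
    have "(\<Sum>i<k. \<rho> i + \<sigma> i) + r \<le> (\<Sum>i<k. \<mu> i + \<nu> i) + (if r = 0 then 0 else \<mu> k)"
      if "r \<le> \<rho> k" for k r
    proof -
      \<comment> \<open>Padding makes \<open>k\<close> a valid row even beyond all nonzero
        parts.\<close>
      define N where "N = M + k + 1"
      have N: "M \<le> N" "k < N" by (simp_all add: N_def)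
      show ?thesis
        by (rule row_closure_imp_sums_le[OF _ total(1)[OF N(1)] N(2) _ _ that])
          (use sub orbits[OF N(1)] parts in \<open>simp_all add: row_closure_def is_partition_def\<close>)
    qed
    note le = this
    show "bipartition_le (\<rho>, \<sigma>) (\<mu>, \<nu>)"
      unfolding bipartition_le_def prod.case
    proof (intro allI conjI)
      fix k
      show *: "(\<Sum>i<k. \<rho> i + \<sigma> i) \<le> (\<Sum>i<k. \<mu> i + \<nu> i)" using le[of 0 k] by simp
      \<comment> \<open>For \<open>\<rho> k = 0\<close> the bound \<open>le\<close> lacks
        \<open>\<mu> k\<close>, and the first inequality is used.\<close>
      show "(\<Sum>i<k. \<rho> i + \<sigma> i) + \<rho> k \<le> (\<Sum>i<k. \<mu> i + \<nu> i) + \<mu> k"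
        using le[of "\<rho> k" k] * by (cases "\<rho> k = 0") auto
    qed
  next
    assume "bipartition_le (\<rho>, \<sigma>) (\<mu>, \<nu>)"
    then have dom: "dominated (interleave \<rho> \<sigma>) (interleave \<mu> \<nu>)"
      by (simp only: bipartition_le_iff_dominated)
    have "sum (interleave p q) {..<m} = dimension"
      if pq: "\<And>N. M \<le> N \<Longrightarrow> (\<Sum>i<N. p i + q i) = dimension" and m: "2 * M \<le> m" for p q m
    proof -
      \<comment> \<open>The length \<open>m\<close> is squeezed between two even lengths, where the
        sum is already \<open>dimension\<close>.\<close>
      have "sum (interleave p q) {..<2 * (m div 2)} \<le> sum (interleave p q) {..<m}"
        "sum (interleave p q) {..<m} \<le> sum (interleave p q) {..<2 * (m div 2 + 1)}"
        by (rule sum_mono2; auto)+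
      then show ?thesis
        unfolding sum_interleave using pq[of "m div 2"] pq[of "m div 2 + 1"] m by simp
    qed
    note tot = this
    have "row_orbit M (\<lambda>k. interleave \<rho> \<sigma> (2 * k)) (\<lambda>k. interleave \<rho> \<sigma> (2 * k + 1))
      \<subseteq> row_closure M (\<lambda>k. interleave \<mu> \<nu> (2 * k)) (\<lambda>k. interleave \<mu> \<nu> (2 * k + 1))"
      using dominated_closure[OF inf two_step_antimono_interleave[OF parts(3,4)]
          two_step_antimono_interleave[OF parts(1,2)] dom] tot[OF total(1)] tot[OF total(2)]
      by simp
    then show "enhanced_orbit scale (\<rho>, \<sigma>) \<subseteq> zariski scale closure_of enhanced_orbit scale (\<mu>, \<nu>)"
      using orbits[OF order_refl] by (simp add: interleave_def row_closure_def)
  qed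
qed

end

theorem theorem3p9:
  fixes scale :: "'f::alg_closed_field \<Rightarrow> 'v::ab_group_add \<Rightarrow> 'v"
    and Basis :: "'v set" and n :: nat
    and \<rho> \<sigma> \<mu> \<nu> :: "nat \<Rightarrow> nat"
  assumes "finite_dimensional_vector_space scale Basis"
    and "vector_space.dim scale UNIV = n"
    and "(\<rho>, \<sigma>) \<in> bipartitions n"
    and "(\<mu>, \<nu>) \<in> bipartitions n"
  shows "enhanced_orbit scale (\<rho>, \<sigma>)
      \<subseteq> zariski scale closure_of enhanced_orbit scale (\<mu>, \<nu>)
    \<longleftrightarrow> bipartition_le (\<rho>, \<sigma>) (\<mu>, \<nu>)"
proof -
  interpret finite_dimensional_vector_space scale Basis by fact
  have "n = dimension" using assms(2) by (simp add: dimension_def)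
  then show ?thesis using orbit_closure_iff[OF alg_closed_infinite] assms(3,4) by simp
qed

end
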